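(* Let $(\mathcal{A},\Gamma,\mathcal{G},\prec)$ be a linear single-matrix graph-directed iterated function system on $\mathbb{R}^d$ with expanding matrix $A$, with invariant sets $\{E_j\}_{j\in\mathcal{A}}$. Suppose that it satisfies the open set condition and that the associated matrix $M$ of the directed graph $(\mathcal{A},\Gamma)$ is primitive. Let $\lambda_M$ be the maximal eigenvalue of $M$, and let $\lambda_{\max}$ and $\lambda_{\min}$ be the maximal modulus and the minimal modulus of the eigenvalues of $A$, respectively. Let $j\in\mathcal{A}$, $\alpha=\dim_\omega E_j$, and let $\psi_j:[0,1]\to E_j$ be a parametrization of $E_j$ which is a measure isomorphism between $([0,1],\mathcal{B}([0,1]),\mathcal{L})$ and $(E_j,\mathcal{B}(E_j),\mathcal{H}^\alpha_\omega)$ and for which there is a constant $c>0$ with $\|\psi_j(x)-\psi_j(y)\|_\omega\le c|x-y|^{1/\alpha}$ for all $x,y\in[0,1]$. Then for any $0<\epsilon<\lambda_{\min}-1$ the following hold, where $\|\cdot\|$ is the Euclidean norm. (1) $\psi_j$ is $\frac{\ln(\lambda_{\max}+\epsilon)}{\ln\lambda_M}$-Hölder continuous where $\|\psi_j(x)-\psi_j(y)\|\ge1$; that is, there is a constant $C>0$ such that $$\|\psi_j(x)-\psi_j(y)\|\le C|x-y|^{\frac{\ln(\lambda_{\max}+\epsilon)}{\ln\lambda_M}}$$ for all $x,y\in[0,1]$ with $\|\psi_j(x)-\psi_j(y)\|\ge1$. (2) $\psi_j$ is $\frac{\ln(\lambda_{\min}-\epsilon)}{\ln\lambda_M}$-Hölder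 continuous where $\|\psi_j(x)-\psi_j(y)\|\le1$; that is, there is a constant $C>0$ such that $$\|\psi_j(x)-\psi_j(y)\|\le C|x-y|^{\frac{\ln(\lambda_{\min}-\epsilon)}{\ln\lambda_M}}$$ for all $x,y\in[0,1]$ with $\|\psi_j(x)-\psi_j(y)\|\le1$.
   Context: **Single-matrix GIFS.** Let $(\mathcal{A},\Gamma)$ be a directed graph with finite vertex set $\mathcal{A}=\{1,\dots,N\}$ and finite edge set $\Gamma$. Let $\Gamma_{ij}$ be the set of edges from $i$ to $j$; for $e\in\Gamma_{ij}$ write $t(e)=j$. A single-matrix graph-directed iterated function system (GIFS) with expanding matrix $A$ is a triple $(\mathcal{A},\Gamma,\mathcal{G})$ with $\mathcal{G}=\{g_e:\mathbb{R}^d\to\mathbb{R}^d;\ e\in\Gamma\}$ and $g_e(x)=A^{-1}(x+d_e)$, where $d_e\in\mathbb{R}^d$ and $A$ is one fixed real $d\times d$ matrix that is expanding (all its eigenvalues have modulus $>1$). Its invariant sets are the unique nonempty compact sets $E_1,\dots,E_N\subset\mathbb{R}^d$ with $E_i=\bigcup_{j=1}^N\bigcup_{e\in\Gamma_{ij}}g_e(E_j)$ for $1\le i\le N$. **Open set condition.** There exist nonempty open sets $U_1,\dots,U_N\subset\mathbb{R}^d$ such that for each $i$, $\bigcup_{j=1}^N\bigcup_{e\in\Gamma_{ij}}g_e(U_j)\subset U_i$ and the sets $g_e(U_j)$ in this union are pairwise disjoint. **Associated matrix.** $M=(m_{ij})_{1\le i,j\le N}$ with $m_{ij}=\sharp\Gamma_{ji}$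 (the number of edges from $j$ to $i$). It is primitive if $M^n$ has all entries positive for some $n\ge1$. **Walks.** $\Gamma_i^k$ is the set of walks $\boldsymbol\gamma=\gamma_1+\dots+\gamma_k$ of length $k$ in the graph (the terminal vertex of each edge is the initial vertex of the next) starting at vertex $i$. Put $\Gamma_i=\Gamma_i^1$, $g_{\boldsymbol\gamma}=g_{\gamma_1}\circ\dots\circ g_{\gamma_k}$ and $E_{\boldsymbol\gamma}=g_{\boldsymbol\gamma}(E_{t(\gamma_k)})$. **Linear GIFS.** An ordered GIFS $(\mathcal{A},\Gamma,\mathcal{G},\prec)$ is a GIFS with a partial order $\prec$ on $\Gamma$ that is a linear order on each $\Gamma_i$, and such that elements of $\Gamma_i$ and $\Gamma_j$ are not comparable if $i\ne j$. It induces the lexicographical (linear) order on each $\Gamma_i^k$. Two distinct walks in $\Gamma_i^k$ are adjacent if no walk of $\Gamma_i^k$ lies strictly between them. The ordered GIFS is linear if for all $i\in\mathcal{A}$ and $k\ge1$, $E_{\boldsymbol\gamma}\cap E_{\boldsymbol\omega}\neq\emptyset$ for all adjacent $\boldsymbol\gamma,\boldsymbol\omega\in\Gamma_i^k$. **Pseudo-norm.** Let $q=|\det A|$, let $B(x,r)$ be the open ball with center $x$ and radius $r$, and let $V=A(B(0,1))\setminus B(0,1)$. Fix $\delta\in(0,\tfrac12)$ and a positive $C^\infty$ function $\phi_\delta$ with support in $B(0,\delta)$, $\phi_\delta(x)=\phi_\delta(-x)$ and $\int\phi_\delta=1$. Set $h(x)=\int_{\mathbb{R}^d}\chi_V(x-y)\phi_\delta(y)\,dy$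 and $$\|x\|_\omega=\sum_{n\in\mathbb{Z}}q^{-n/d}h(A^nx),\qquad x\in\mathbb{R}^d.$$ **Hausdorff measure and dimension for the pseudo-norm.** For $E\subset\mathbb{R}^d$ let $\mathrm{diam}_\omega E=\sup\{\|x-y\|_\omega: x,y\in E\}$. For $s\ge0$, $\delta>0$, let $$\mathcal{H}^s_{\omega,\delta}(E)=\inf\Big\{\sum_{i=1}^\infty(\mathrm{diam}_\omega E_i)^s:\ E\subset\bigcup_iE_i,\ \mathrm{diam}_\omega E_i\le\delta\Big\},\qquad \mathcal{H}^s_\omega(E)=\lim_{\delta\to0}\mathcal{H}^s_{\omega,\delta}(E),$$ and $\dim_\omega E=\inf\{s:\mathcal{H}^s_\omega(E)=0\}=\sup\{s:\mathcal{H}^s_\omega(E)=\infty\}$. **Parametrization, measure isomorphism.** A parametrization of a compact set $E$ is a continuous onto map $\psi:[0,1]\to E$. $\mathcal{L}$ is Lebesgue measure and $\mathcal{B}(X)$ the Borel $\sigma$-algebra of $X$. The map $\psi$ is a measure isomorphism between $([0,1],\mathcal{B}([0,1]),\mathcal{L})$ and $(E,\mathcal{B}(E),\mathcal{H}^\alpha_\omega)$ if there exist $E'\subset E$ and $I'\subset[0,1]$ of full measure such that $\psi:I'\to E'$ is a bijection, and, with $c=\mathcal{H}^\alpha_\omega(E)$, $\mathcal{H}^\alpha_\omega(\psi(F))=c\,\mathcal{L}(F)$ and $\mathcal{L}(\psi^{-1}(B))=c^{-1}\mathcal{H}^\alpha_\omega(B)$ for all Borel sets $F\subset[0,1]$ and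 $B\subset E$. *)

theory Defs
  imports "HOL-Analysis.Analysis" "Graph_Theory.Arc_Walk"
begin

section \<open>Matrices\<close>

definition eigenvalues :: "real^'n^'n \<Rightarrow> complex set" where
  "eigenvalues A = {\<mu>. \<exists>v. v \<noteq> 0 \<and> map_matrix complex_of_real A *v v = \<mu> *s v}"

definition expanding :: "real^'n^'n \<Rightarrow> bool" where
  "expanding A \<longleftrightarrow> (\<forall>\<mu>\<in>eigenvalues A. cmod \<mu> > 1)"

definition max_modulus :: "real^'n^'n \<Rightarrow> real" where
  "max_modulus A = Max (cmod ` eigenvalues A)"

definition min_modulus :: "real^'n^'n \<Rightarrow> real" where
  "min_modulus A = Min (cmod ` eigenvalues A)"

text \<open>The largest real eigenvalue; for a primitive matrix this is the Perron eigenvalue.\<close>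
definition max_eigenvalue :: "real^'n^'n \<Rightarrow> real" where
  "max_eigenvalue M = Max {x::real. complex_of_real x \<in> eigenvalues M}"

text \<open>Powers are spelled out with \<open>**\<close>, since \<open>*\<close> on vectors is componentwise.\<close>
definition primitive_matrix :: "real^'n^'n \<Rightarrow> bool" where
  "primitive_matrix M \<longleftrightarrow> (\<exists>n\<ge>1. \<forall>i j. (((**) M ^^ n) (mat 1)) $ i $ j > 0)"

definition int_iterate :: "real^'n^'n \<Rightarrow> int \<Rightarrow> real^'n \<Rightarrow> real^'n" where
  "int_iterate A n x =
    (if n \<ge> 0 then ((*v) A ^^ nat n) x else ((*v) (matrix_inv A) ^^ nat (- n)) x)"


section \<open>Graph-directed iterated function systems\<close>

text \<open>
  The vertices of \<open>G\<close> form the finite type \<open>'v\<close>; parallel arcs and loops are allowed.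
  The translation of the map attached to the arc \<open>e\<close> is \<open>D e\<close>.
\<close>

definition gmap :: "real^'n^'n \<Rightarrow> ('e \<Rightarrow> real^'n) \<Rightarrow> 'e \<Rightarrow> real^'n \<Rightarrow> real^'n" where
  "gmap A D e x = matrix_inv A *v (x + D e)"

definition gifs :: "('v::finite, 'e) pre_digraph \<Rightarrow> real^'n^'n \<Rightarrow> bool" where
  "gifs G A \<longleftrightarrow> fin_digraph G \<and> verts G = UNIV \<and> expanding A"

definition invariant_sets ::
  "('v::finite, 'e) pre_digraph \<Rightarrow> real^'n^'n \<Rightarrow> ('e \<Rightarrow> real^'n) \<Rightarrow> ('v \<Rightarrow> (real^'n) set) \<Rightarrow> bool" where
  "invariant_sets G A D E \<longleftrightarrow>
    (\<forall>i. E i \<noteq> {} \<and> compact (E i) \<and> E i = (\<Union>e\<in>out_arcs G i. gmap A D e ` E (head G e)))"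

definition open_set_condition ::
  "('v::finite, 'e) pre_digraph \<Rightarrow> real^'n^'n \<Rightarrow> ('e \<Rightarrow> real^'n) \<Rightarrow> bool" where
  "open_set_condition G A D \<longleftrightarrow>
    (\<exists>U :: 'v \<Rightarrow> (real^'n) set. \<forall>i. open (U i) \<and> U i \<noteq> {} \<and>
      (\<Union>e\<in>out_arcs G i. gmap A D e ` U (head G e)) \<subseteq> U i \<and>
      disjoint_family_on (\<lambda>e. gmap A D e ` U (head G e)) (out_arcs G i))"

definition associated_matrix :: "('v::finite, 'e) pre_digraph \<Rightarrow> real^'v^'v" where
  "associated_matrix G = (\<chi> i j. real (card {e \<in> arcs G. tail G e = j \<and> head G e = i}))"

definition walks :: "('v, 'e) pre_digraph \<Rightarrow> nat \<Rightarrow> 'v \<Rightarrow> 'e list set" where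
  "walks G k i = {p. length p = k \<and> (\<exists>v. pre_digraph.awalk G i p v)}"

definition walk_map :: "real^'n^'n \<Rightarrow> ('e \<Rightarrow> real^'n) \<Rightarrow> 'e list \<Rightarrow> real^'n \<Rightarrow> real^'n" where
  "walk_map A D p = foldr (\<circ>) (map (gmap A D) p) id"

text \<open>Only used for nonempty walks \<open>p\<close>.\<close>
definition walk_set ::
  "('v, 'e) pre_digraph \<Rightarrow> real^'n^'n \<Rightarrow> ('e \<Rightarrow> real^'n) \<Rightarrow> ('v \<Rightarrow> (real^'n) set)
    \<Rightarrow> 'e list \<Rightarrow> (real^'n) set" where
  "walk_set G A D E p = walk_map A D p ` E (head G (last p))"

text \<open>The relation \<open>r\<close> is the strict order on the arcs.\<close>
definition gifs_order :: "('v, 'e) pre_digraph \<Rightarrow> ('e \<times> 'e) set \<Rightarrow> bool" where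
  "gifs_order G r \<longleftrightarrow> r \<subseteq> arcs G \<times> arcs G \<and> irrefl r \<and> trans r \<and>
    (\<forall>i. total_on (out_arcs G i) r) \<and> (\<forall>(e, f)\<in>r. tail G e = tail G f)"

definition adjacent_walks ::
  "('v, 'e) pre_digraph \<Rightarrow> ('e \<times> 'e) set \<Rightarrow> nat \<Rightarrow> 'v \<Rightarrow> 'e list \<Rightarrow> 'e list \<Rightarrow> bool" where
  "adjacent_walks G r k i p q \<longleftrightarrow> p \<in> walks G k i \<and> q \<in> walks G k i \<and> p \<noteq> q \<and>
    \<not> (\<exists>w\<in>walks G k i. (p, w) \<in> lex r \<and> (w, q) \<in> lex r \<or> (q, w) \<in> lex r \<and> (w, p) \<in> lex r)"

definition linear_gifs ::
  "('v::finite, 'e) pre_digraph \<Rightarrow> real^'n^'n \<Rightarrow> ('e \<Rightarrow> real^'n) \<Rightarrow> ('v \<Rightarrow> (real^'n) set)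
    \<Rightarrow> ('e \<times> 'e) set \<Rightarrow> bool" where
  "linear_gifs G A D E r \<longleftrightarrow> gifs G A \<and> invariant_sets G A D E \<and> gifs_order G r \<and>
    (\<forall>i. \<forall>k\<ge>1. \<forall>p q. adjacent_walks G r k i p q \<longrightarrow>
      walk_set G A D E p \<inter> walk_set G A D E q \<noteq> {})"


section \<open>The pseudo-norm\<close>

primrec C_k :: "nat \<Rightarrow> ('a::real_normed_vector \<Rightarrow> real) \<Rightarrow> bool" where
  "C_k 0 f \<longleftrightarrow> continuous_on UNIV f"
| "C_k (Suc k) f \<longleftrightarrow> f differentiable_on UNIV \<and>
    (\<forall>v. C_k k (\<lambda>x. frechet_derivative f (at x) v))"

text \<open>
  A positive function supported in a ball can only be strictly positive inside that ball.
  Positivity there (rather than mere nonnegativity) is what makes the pseudo-norm vanish at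
  the origin only.
\<close>
definition mollifier :: "real \<Rightarrow> (real^'n \<Rightarrow> real) \<Rightarrow> bool" where
  "mollifier \<delta> \<phi> \<longleftrightarrow> (\<forall>k. C_k k \<phi>) \<and>
    (\<forall>x\<in>ball 0 \<delta>. \<phi> x > 0) \<and> (\<forall>x. x \<notin> ball 0 \<delta> \<longrightarrow> \<phi> x = 0) \<and>
    (\<forall>x. \<phi> x = \<phi> (- x)) \<and> (LINT x|lborel. \<phi> x) = 1"

definition shell :: "real^'n^'n \<Rightarrow> (real^'n) set" where
  "shell A = (*v) A ` ball 0 1 - ball 0 1"

definition smoothed_shell :: "real^'n^'n \<Rightarrow> (real^'n \<Rightarrow> real) \<Rightarrow> real^'n \<Rightarrow> real" where
  "smoothed_shell A \<phi> x = (LINT y|lborel. indicator (shell A) (x - y) * \<phi> y)"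

definition pnorm :: "real^'n^'n \<Rightarrow> (real^'n \<Rightarrow> real) \<Rightarrow> real^'n \<Rightarrow> real" where
  "pnorm A \<phi> x =
    (\<Sum>\<^sub>\<infinity>n::int. \<bar>det A\<bar> powr (- of_int n / real CARD('n)) * smoothed_shell A \<phi> (int_iterate A n x))"


section \<open>Hausdorff measure and dimension for the pseudo-norm\<close>

definition diam_w :: "real^'n^'n \<Rightarrow> (real^'n \<Rightarrow> real) \<Rightarrow> (real^'n) set \<Rightarrow> ennreal" where
  "diam_w A \<phi> S = (SUP x\<in>S. SUP y\<in>S. ennreal (pnorm A \<phi> (x - y)))"

text \<open>
  The summand \<open>(diam S)\<^sup>s\<close>. For \<open>s = 0\<close> the usual convention applies: empty sets count 0,
  all others 1. It is only applied to sets of finite diameter.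
\<close>
definition diam_pow :: "real^'n^'n \<Rightarrow> (real^'n \<Rightarrow> real) \<Rightarrow> real \<Rightarrow> (real^'n) set \<Rightarrow> ennreal" where
  "diam_pow A \<phi> s S =
    (if S = {} then 0 else if s = 0 then 1 else ennreal (enn2real (diam_w A \<phi> S) powr s))"

definition hausdorff_pre ::
  "real^'n^'n \<Rightarrow> (real^'n \<Rightarrow> real) \<Rightarrow> real \<Rightarrow> real \<Rightarrow> (real^'n) set \<Rightarrow> ennreal" where
  "hausdorff_pre A \<phi> s \<delta> X =
    Inf {(\<Sum>i. diam_pow A \<phi> s (S i)) | S :: nat \<Rightarrow> (real^'n) set.
      X \<subseteq> (\<Union>i. S i) \<and> (\<forall>i. diam_w A \<phi> (S i) \<le> ennreal \<delta>)}"

definition hausdorff_w ::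
  "real^'n^'n \<Rightarrow> (real^'n \<Rightarrow> real) \<Rightarrow> real \<Rightarrow> (real^'n) set \<Rightarrow> ennreal" where
  "hausdorff_w A \<phi> s X = Lim (at_right 0) (\<lambda>\<delta>. hausdorff_pre A \<phi> s \<delta> X)"

definition dim_w :: "real^'n^'n \<Rightarrow> (real^'n \<Rightarrow> real) \<Rightarrow> (real^'n) set \<Rightarrow> real" where
  "dim_w A \<phi> X = Inf {s. s \<ge> 0 \<and> hausdorff_w A \<phi> s X = 0}"


section \<open>Parametrizations\<close>

definition parametrization :: "(real^'n) set \<Rightarrow> (real \<Rightarrow> real^'n) \<Rightarrow> bool" where
  "parametrization X \<psi> \<longleftrightarrow> continuous_on {0..1} \<psi> \<and> \<psi> ` {0..1} = X"

text \<open>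
  Borel sets of the subspaces \<open>[0,1]\<close> and \<open>X\<close> (compact in the application) are the Borel sets
  of the ambient space contained in them. The second identity with \<open>B = X\<close> forces
  \<open>0 < c < \<infinity>\<close>, because \<open>inverse c * c = 0\<close> otherwise.
\<close>
definition measure_isomorphism ::
  "real^'n^'n \<Rightarrow> (real^'n \<Rightarrow> real) \<Rightarrow> real \<Rightarrow> (real^'n) set \<Rightarrow> (real \<Rightarrow> real^'n) \<Rightarrow> bool" where
  "measure_isomorphism A \<phi> \<alpha> X \<psi> \<longleftrightarrow>
    (\<exists>X' I'. X' \<subseteq> X \<and> I' \<subseteq> {0..1} \<and> hausdorff_w A \<phi> \<alpha> (X - X') = 0 \<and>
      {0..1} - I' \<in> null_sets lebesgue \<and> bij_betw \<psi> I' X') \<and>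
    (let c = hausdorff_w A \<phi> \<alpha> X in
      (\<forall>F\<in>sets borel. F \<subseteq> {0..1} \<longrightarrow> hausdorff_w A \<phi> \<alpha> (\<psi> ` F) = c * emeasure lborel F) \<and>
      (\<forall>B\<in>sets borel. B \<subseteq> X \<longrightarrow>
        emeasure lborel (\<psi> -` B \<inter> {0..1}) = inverse c * hausdorff_w A \<phi> \<alpha> B))"

end

theory Submission
  imports Defs "HOL-Computational_Algebra.Fundamental_Theorem_Algebra"
begin

text \<open>
  Let \<open>q = \<bar>det A\<bar>\<close> and let \<open>d\<close> be the dimension of the space. The pseudo-norm turns \<open>A\<close> into a
  similarity: \<open>\<parallel>A x\<parallel>\<^sub>\<omega> = q powr (1 / d) * \<parallel>x\<parallel>\<^sub>\<omega>\<close> (\<open>pnorm_mult\<close>). It is bounded below by a positive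
  constant on the shell \<open>V = A(B(0,1)) - B(0,1)\<close> (\<open>pnorm_ge_on_shell\<close>), and every nonzero point is
  \<open>A ^ m z\<close> with \<open>z \<in> V\<close> and an integer \<open>m\<close>. Hence \<open>\<parallel>x\<parallel>\<^sub>\<omega>\<close> is at least a multiple of
  \<open>q powr (m / d)\<close>. The Euclidean norm of \<open>A ^ m z\<close>, on the other hand, is at most a multiple of
  \<open>(\<lambda>\<^sub>m\<^sub>a\<^sub>x + \<epsilon>) ^ m\<close> for \<open>m \<ge> 0\<close> and of \<open>(\<lambda>\<^sub>m\<^sub>i\<^sub>n - \<epsilon>) ^ m\<close> for \<open>m \<le> 0\<close> (\<open>iterate_bound\<close>,
  \<open>inverse_iterate_bound\<close>). Eliminating \<open>m\<close> bounds the Euclidean norm by a power of the pseudo-norm,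
  with exponent \<open>d * ln (\<lambda>\<^sub>m\<^sub>a\<^sub>x + \<epsilon>) / ln q\<close> outside the unit ball and
  \<open>d * ln (\<lambda>\<^sub>m\<^sub>i\<^sub>n - \<epsilon>) / ln q\<close> inside (\<open>norm_le_pnorm_outside_ball\<close>, \<open>norm_le_pnorm_inside_ball\<close>).
  
  The given bound on \<open>\<parallel>\<psi> x - \<psi> y\<parallel>\<^sub>\<omega>\<close> has exponent \<open>1 / \<alpha>\<close>, so the estimates follow from
  \<open>0 < \<alpha> \<le> d * ln \<lambda>\<^sub>M / ln q\<close>: distances in \<open>[0,1]\<close> are at most 1, and for them a smaller \<open>\<alpha>\<close> gives
  a stronger bound. The upper bound on the dimension comes from the covers of an invariant set by its
  pieces along the walks of length \<open>k\<close>. These have pseudo-norm diameter at most a multiple of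
  \<open>q powr (- k / d)\<close>, and there are at most a multiple of \<open>\<rho> ^ k\<close> of them, where \<open>\<rho>\<close> is the eigenvalue of
  a positive eigenvector of the associated matrix (\<open>perron_eigenvector\<close>); it is real, so
  \<open>\<rho> \<le> \<lambda>\<^sub>M\<close>. Positivity of \<open>\<alpha>\<close> comes from the measure isomorphism, as points are not null sets of
  the counting measure (\<open>measure_isomorphism_dim_nonzero\<close>). With the upper bound it gives
  \<open>1 < \<rho> \<le> \<lambda>\<^sub>M\<close>, so the logarithm of \<open>\<lambda>\<^sub>M\<close> is positive.
\<close>

section \<open>Growth of the iterates of a matrix\<close>

lemma norm_vector_smult:
  fixes x :: "complex^'n"
  shows "norm (c *s x) = cmod c * norm x"
  by (simp add: norm_vec_def norm_mult L2_set_right_distrib)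

text \<open>
  The vector \<open>p(B) x\<close>. Evaluating at a vector keeps the argument inside \<open>complex^'n\<close>, and
  factors of \<open>p\<close> can be moved from the operator onto the vector (\<open>op_poly_linear_factor\<close>).
\<close>
definition op_poly :: "complex poly \<Rightarrow> complex^'n^'n \<Rightarrow> complex^'n \<Rightarrow> complex^'n" where
  "op_poly p B x = (\<Sum>i\<le>degree p. coeff p i *s ((*v) B ^^ i) x)"

lemma op_poly_eq_sum:
  assumes "degree p \<le> n"
  shows "op_poly p B x = (\<Sum>i\<le>n. coeff p i *s ((*v) B ^^ i) x)"
  unfolding op_poly_def
  by (rule sum.mono_neutral_left) (use assms in \<open>auto simp: coeff_eq_0\<close>)

lemma linear_iterate:
  fixes B :: "'a::real_algebra_1^'n^'n"
  shows "linear ((*v) B ^^ i)"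
proof (induction i)
  case 0
  show ?case by (simp add: linear_id[unfolded id_def] id_def)
next
  case (Suc i)
  show ?case
    using linear_compose[OF Suc matrix_vector_mul_linear[of B]] by (simp only: funpow.simps)
qed

lemma iterate_vector_smult:
  fixes B :: "'a::field^'n^'n"
  shows "((*v) B ^^ i) (c *s x) = c *s ((*v) B ^^ i) x"
  by (induction i) (simp_all add: vector_scalar_commute)

lemma op_poly_diff: "op_poly p B (x - y) = op_poly p B x - op_poly p B y"
  unfolding op_poly_def
  by (simp add: linear_diff[OF linear_iterate] vector_ssub_ldistrib sum_subtractf)

lemma op_poly_vector_smult: "op_poly p B (c *s x) = c *s op_poly p B x"
  unfolding op_poly_def
  by (simp add: iterate_vector_smult vec.scale_sum_right mult.commute)

lemma op_poly_apply: "op_poly p B (B *v x) = B *v op_poly p B x"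
  unfolding op_poly_def
  by (simp add: linear_sum[OF matrix_vector_mul_linear] funpow_swap1 vector_scalar_commute)

lemma op_poly_linear_factor:
  "op_poly ([:- a, 1:] * s) B x = op_poly s B (B *v x - a *s x)"
proof -
  let ?n = "degree s"
  have "degree ([:- a, 1:] * s) \<le> Suc ?n"
    using degree_mult_le[of "[:- a, 1:]" s] by simp
  then have "op_poly ([:- a, 1:] * s) B x
      = (\<Sum>i\<le>Suc ?n. coeff ([:- a, 1:] * s) i *s ((*v) B ^^ i) x)"
    by (rule op_poly_eq_sum)
  also have "\<dots> = (\<Sum>i\<le>Suc ?n. coeff (pCons 0 s) i *s ((*v) B ^^ i) x)
      - (\<Sum>i\<le>Suc ?n. (a * coeff s i) *s ((*v) B ^^ i) x)"
    by (simp add: vector_ssub_ldistrib vector_sadd_rdistrib sum_subtractf[symmetric]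
        algebra_simps del: sum.atMost_Suc)
  also have "(\<Sum>i\<le>Suc ?n. coeff (pCons 0 s) i *s ((*v) B ^^ i) x) = op_poly s B (B *v x)"
    by (simp add: sum.atMost_Suc_shift op_poly_def funpow_swap1 del: sum.atMost_Suc)
  also have "(\<Sum>i\<le>Suc ?n. (a * coeff s i) *s ((*v) B ^^ i) x) = op_poly s B (a *s x)"
    unfolding op_poly_vector_smult op_poly_eq_sum[of s "Suc ?n", OF le_SucI[OF order_refl]]
    by (simp add: vec.scale_sum_right del: sum.atMost_Suc)
  finally show ?thesis by (simp add: op_poly_diff)
qed

lemma op_poly_eigenvector:
  assumes "B *v v = a *s v"
  shows "op_poly p B v = poly p a *s v"
proof -
  have "((*v) B ^^ i) v = a ^ i *s v" for i
    by (induction i) (simp_all add: vector_scalar_commute assms mult.commute)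
  then show ?thesis
    by (simp add: op_poly_def poly_altdef vec.scale_sum_left)
qed

text \<open>
  Linear dependence of a sequence, which may have repetitions; a repetition is itself a relation.
\<close>
lemma dependent_sequence:
  fixes f :: "nat \<Rightarrow> 'a::euclidean_space"
  obtains c :: "nat \<Rightarrow> real" and n where "\<exists>i\<le>n. c i \<noteq> 0" "(\<Sum>i\<le>n. c i *\<^sub>R f i) = 0"
proof (cases "inj_on f {..DIM('a)}")
  case True
  have "dependent (f ` {..DIM('a)})"
    by (rule dependent_biggerset) (simp add: card_image[OF True])
  then obtain u v where v: "v \<in> f ` {..DIM('a)}" "u v \<noteq> 0"
    and s: "(\<Sum>v\<in>f ` {..DIM('a)}. u v *\<^sub>R v) = 0"
    by (auto simp: real_vector.dependent_finite)
  have "(\<Sum>i\<le>DIM('a). u (f i) *\<^sub>R f i) = 0"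
    using s by (simp add: sum.reindex[OF True])
  then show ?thesis using v that[of "DIM('a)" "\<lambda>i. u (f i)"] by auto
next
  case False
  then obtain i j where ij: "i \<le> DIM('a)" "j \<le> DIM('a)" "i \<noteq> j" "f i = f j"
    by (auto simp: inj_on_def)
  have "(\<Sum>k\<le>DIM('a). (of_bool (k = i) - of_bool (k = j) :: real) *\<^sub>R f k) = 0"
    using ij by (simp add: scaleR_diff_left sum_subtractf of_bool_def if_distrib[of "\<lambda>c. c *\<^sub>R _"] cong: if_cong)
  then show ?thesis
    using ij by (intro that[of "DIM('a)" "\<lambda>k. of_bool (k = i) - of_bool (k = j)"]) (auto intro!: exI[of _ i])
qed

text \<open>
  The powers of \<open>B\<close> live in a space of finite real dimension, so finitely many of them satisfy a
  linear relation, already with real coefficients. Applying it to vectors gives one polynomial that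
  works for all of them at once; this uniformity is what makes the set of eigenvalues finite.
\<close>
lemma annihilating_polynomial:
  fixes B :: "complex^'n^'n"
  obtains p where "p \<noteq> 0" "\<And>x. op_poly p B x = 0"
proof -
  define P where "P i = ((**) B ^^ i) (mat 1)" for i
  obtain c :: "nat \<Rightarrow> real" and n where c: "\<exists>i\<le>n. c i \<noteq> 0" "(\<Sum>i\<le>n. c i *\<^sub>R P i) = 0"
    by (rule dependent_sequence)
  define p where "p = (\<Sum>i\<le>n. monom (complex_of_real (c i)) i)"
  have coeff: "coeff p i = (if i \<le> n then c i else 0)" for i
    by (simp add: p_def coeff_sum sum.delta)
  have P: "P i *v x = ((*v) B ^^ i) x" for i x
    by (induction i) (simp_all add: P_def matrix_vector_mul_assoc[symmetric])
  have "op_poly p B x = 0" for x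
  proof -
    have "degree p \<le> n" by (rule degree_le) (simp add: coeff)
    then have "op_poly p B x = (\<Sum>i\<le>n. c i *\<^sub>R (P i *v x))"
      unfolding op_poly_eq_sum[OF \<open>degree p \<le> n\<close>] P
      by (intro sum.cong) (simp_all add: coeff vec_eq_iff scaleR_conv_of_real[where 'a = complex])
    also have "\<dots> = (\<Sum>i\<le>n. c i *\<^sub>R P i) *v x"
      by (simp add: vec_eq_iff matrix_vector_mult_def scaleR_sum_right sum_distrib_right
          sum.swap[of _ UNIV])
    finally show ?thesis by (simp add: c)
  qed
  moreover have "p \<noteq> 0" using c(1) coeff by (metis coeff_0 of_real_eq_0_iff)
  ultimately show ?thesis using that by blast
qed

text \<open>
  The inhomogeneous term grows like \<open>r ^ n\<close> and the homogeneous factor \<open>a\<close> is smaller than \<open>r\<close>,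
  so the recursion preserves a bound \<open>K * r ^ n\<close> as soon as \<open>a K + C \<le> K r\<close>.
\<close>
lemma scalar_recursion_bound:
  fixes b :: "nat \<Rightarrow> real"
  assumes "0 \<le> a" "a < r" "\<And>n. b (Suc n) \<le> a * b n + C * r ^ n"
  shows "\<exists>K. \<forall>n. b n \<le> K * r ^ n"
proof -
  \<comment> \<open>the first term serves the base case, the second the induction step\<close>
  define K where "K = max (b 0) (C / (r - a))"
  have K: "a * K + C \<le> K * r"
  proof -
    have "C / (r - a) \<le> K" by (simp add: K_def)
    then show ?thesis using assms(2) by (simp add: field_simps)
  qed
  have "b n \<le> K * r ^ n" for n
  proof (induction n)
    case 0
    show ?case by (simp add: K_def)
  next
    case (Suc n)
    have "b (Suc n) \<le> a * (K * r ^ n) + C * r ^ n"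
      using assms(3)[of n] mult_left_mono[OF Suc assms(1)] by linarith
    also have "\<dots> = (a * K + C) * r ^ n" by (simp add: algebra_simps)
    also have "\<dots> \<le> (K * r) * r ^ n"
      by (rule mult_right_mono[OF K]) (use assms in simp)
    finally show ?case by simp
  qed
  then show ?thesis by blast
qed

text \<open>
  A bound for the orbit of one vector without the Jordan normal form, by induction on the degree of a
  polynomial \<open>p\<close> with \<open>p(B) x = 0\<close>. Split off a root \<open>a\<close>, \<open>p = (X - a) s\<close>. If \<open>s(B) x = 0\<close>, the
  degree has dropped. Otherwise \<open>s(B) x\<close> is an eigenvector for \<open>a\<close>, hence \<open>cmod a < r\<close>; the vector
  \<open>y = B x - a x\<close> is annihilated by \<open>s\<close>, so its orbit is \<open>O(r ^ n)\<close>, and the orbit of \<open>x\<close> satisfies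
  \<open>B ^ (n + 1) x = a B ^ n x + B ^ n y\<close>.
\<close>
lemma orbit_bound:
  fixes B :: "complex^'n^'n"
  assumes r: "\<And>a v. v \<noteq> 0 \<Longrightarrow> B *v v = a *s v \<Longrightarrow> cmod a < r"
    and "p \<noteq> 0" "op_poly p B x = 0"
  shows "\<exists>C. \<forall>n. norm (((*v) B ^^ n) x) \<le> C * r ^ n"
  using assms(2,3)
proof (induction "degree p" arbitrary: p x)
  case 0
  then obtain c where "p = [:c:]" by (metis degree_eq_zeroE)
  then have "c \<noteq> 0" "c *s x = 0" using 0 by (auto simp: op_poly_def)
  then have "x = 0" by simp
  then show ?case by (intro exI[of _ 0]) (simp add: linear_0[OF linear_iterate])
next
  case (Suc m)
  have "\<not> constant (poly p)" using Suc(2) by (simp add: constant_degree)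
  then obtain a where "poly p a = 0" using fundamental_theorem_of_algebra by blast
  then obtain s where s: "p = [:- a, 1:] * s" by (auto simp: poly_eq_0_iff_dvd)
  then have "s \<noteq> 0" using Suc by auto
  have "degree p = degree [:- a, 1:] + degree s"
    unfolding s by (rule degree_mult_eq) (use \<open>s \<noteq> 0\<close> in auto)
  then have deg: "m = degree s" using Suc(2) by simp
  let ?y = "B *v x - a *s x"
  have y: "op_poly s B ?y = 0" using Suc(4) unfolding s op_poly_linear_factor .
  show ?case
  proof (cases "op_poly s B x = 0")
    case True
    show ?thesis by (rule Suc(1)[OF deg \<open>s \<noteq> 0\<close> True])
  next
    case False
    have "B *v op_poly s B x = a *s op_poly s B x"
      using y by (simp add: op_poly_diff op_poly_vector_smult op_poly_apply)
    then have "cmod a < r" using r False by blast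
    obtain C where C: "norm (((*v) B ^^ n) ?y) \<le> C * r ^ n" for n
      using Suc(1)[OF deg \<open>s \<noteq> 0\<close> y] by blast
    have "norm (((*v) B ^^ Suc n) x) \<le> cmod a * norm (((*v) B ^^ n) x) + C * r ^ n" for n
    proof -
      have "((*v) B ^^ Suc n) x = a *s ((*v) B ^^ n) x + ((*v) B ^^ n) ?y"
        by (simp add: linear_diff[OF linear_iterate] iterate_vector_smult funpow_swap1)
      then have "norm (((*v) B ^^ Suc n) x) \<le> norm (a *s ((*v) B ^^ n) x) + norm (((*v) B ^^ n) ?y)"
        by (metis norm_triangle_ineq)
      then show ?thesis using C[of n] by (simp add: norm_vector_smult)
    qed
    then show ?thesis
      using scalar_recursion_bound[of "cmod a" r "\<lambda>n. norm (((*v) B ^^ n) x)" C] \<open>cmod a < r\<close>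
      by auto
  qed
qed

section \<open>Spectral estimates for real and for expanding matrices\<close>

definition complexify :: "real^'n \<Rightarrow> complex^'n" where
  "complexify x = (\<chi> i. complex_of_real (x $ i))"

lemma norm_complexify [simp]: "norm (complexify x) = norm x"
  by (simp add: complexify_def norm_vec_def)

lemma complexify_eq_0_iff [simp]: "complexify x = 0 \<longleftrightarrow> x = 0"
  by (metis norm_complexify norm_eq_zero)

lemma complexify_scale: "complexify (c *\<^sub>R x) = complex_of_real c *s complexify x"
  by (simp add: complexify_def vec_eq_iff)

lemma complexify_mult: "complexify (A *v x) = map_matrix complex_of_real A *v complexify x"
  by (simp add: complexify_def vec_eq_iff matrix_vector_mult_def map_matrix_def)

lemma complexify_iterate:
  fixes A :: "real^'n^'n"
  shows "complexify (((*v) A ^^ n) x) = ((*v) (map_matrix complex_of_real A) ^^ n) (complexify x)"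
  by (induction n) (simp_all add: complexify_mult)

lemma real_eigenvector_imp_eigenvalue:
  assumes "v \<noteq> 0" "A *v v = c *\<^sub>R v"
  shows "complex_of_real c \<in> eigenvalues A"
  unfolding eigenvalues_def
  using assms complexify_mult[of A v] by (auto simp: complexify_scale intro!: exI[of _ "complexify v"])

text \<open>
  Every eigenvalue is a root of an annihilating polynomial.
\<close>
lemma finite_eigenvalues: "finite (eigenvalues A)"
proof -
  obtain p where p: "p \<noteq> 0" "\<And>x. op_poly p (map_matrix complex_of_real A) x = 0"
    by (rule annihilating_polynomial) blast
  have "eigenvalues A \<subseteq> {z. poly p z = 0}"
    using p(2) by (auto simp: eigenvalues_def dest!: op_poly_eigenvector[of _ _ _ p])
  then show ?thesis using poly_roots_finite[OF p(1)] finite_subset by blast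
qed

text \<open>
  The orbit bound for the finitely many basis vectors, summed up: the constant becomes uniform in the
  vector.
\<close>
lemma iterate_bound:
  fixes A :: "real^'n^'n"
  assumes r: "\<And>a. a \<in> eigenvalues A \<Longrightarrow> cmod a < r" "0 \<le> r"
  obtains C where "0 < C" "\<And>n x. norm (((*v) A ^^ n) x) \<le> C * r ^ n * norm x"
proof -
  let ?B = "map_matrix complex_of_real A"
  obtain p where p: "p \<noteq> 0" "\<And>x. op_poly p ?B x = 0"
    by (rule annihilating_polynomial) blast
  have "\<exists>C. \<forall>n. norm (((*v) A ^^ n) x) \<le> C * r ^ n" for x
    using orbit_bound[of ?B r p "complexify x", OF _ p] r(1)
    by (force simp: eigenvalues_def complexify_iterate[symmetric])
  then have "\<forall>i. \<exists>C. \<forall>n. norm (((*v) A ^^ n) (axis i 1)) \<le> C * r ^ n"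
    by blast
  then obtain c where c: "norm (((*v) A ^^ n) (axis i 1)) \<le> c i * r ^ n" for n i
    unfolding choice_iff by blast
  define C where "C = 1 + (\<Sum>i\<in>UNIV. c i)"
  have c0: "0 \<le> c i" for i
    using order_trans[OF norm_ge_zero c[of 0 i]] by simp
  have "norm (((*v) A ^^ n) x) \<le> C * r ^ n * norm x" for n x
  proof -
    have "((*v) A ^^ n) x = ((*v) A ^^ n) (\<Sum>i\<in>UNIV. x $ i *\<^sub>R axis i 1)"
      using basis_expansion[of x] by (simp add: scalar_mult_eq_scaleR)
    also have "\<dots> = (\<Sum>i\<in>UNIV. x $ i *\<^sub>R ((*v) A ^^ n) (axis i 1))"
      by (simp add: linear_sum[OF linear_iterate] linear_cmul[OF linear_iterate])
    also have "norm \<dots> \<le> (\<Sum>i\<in>UNIV. norm x * (c i * r ^ n))"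
      by (rule sum_norm_le) (auto intro!: mult_mono c component_le_norm_cart)
    also have "\<dots> = (\<Sum>i\<in>UNIV. c i) * (r ^ n * norm x)"
      unfolding sum_distrib_right by (rule sum.cong) simp_all
    also have "\<dots> \<le> C * (r ^ n * norm x)"
      by (rule mult_right_mono) (use r in \<open>auto simp: C_def\<close>)
    finally show ?thesis by (simp add: mult.assoc)
  qed
  moreover have "0 < C" using sum_nonneg[of UNIV c] c0 by (simp add: C_def add_pos_nonneg)
  ultimately show ?thesis using that by blast
qed

text \<open>
  Without eigenvalues the bound of \<open>iterate_bound\<close> holds with \<open>r = 0\<close> and makes \<open>A\<close> vanish; but
  then 0 is an eigenvalue.
\<close>
lemma eigenvalues_nonempty: "eigenvalues (A :: real^'n^'n) \<noteq> {}"
proof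
  assume e: "eigenvalues A = {}"
  obtain C where C: "\<And>n x. norm (((*v) A ^^ n) x) \<le> C * 0 ^ n * norm x"
    by (rule iterate_bound[of A 0]) (use e in auto)
  define x :: "real^'n" where "x = axis undefined 1"
  have "A *v x = 0" using C[of 1 x] by simp
  then have "complex_of_real 0 \<in> eigenvalues A"
    by (intro real_eigenvector_imp_eigenvalue[of x]) (simp_all add: x_def axis_eq_0_iff)
  then show False by (simp add: e)
qed

lemma cmod_le_max_modulus: "a \<in> eigenvalues A \<Longrightarrow> cmod a \<le> max_modulus A"
  unfolding max_modulus_def by (simp add: finite_eigenvalues)

lemma min_modulus_le_cmod: "a \<in> eigenvalues A \<Longrightarrow> min_modulus A \<le> cmod a"
  unfolding min_modulus_def by (simp add: finite_eigenvalues)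

lemma expanding_imp_invertible:
  assumes "expanding A"
  shows "invertible (A :: real^'n^'n)"
proof -
  have "A *v v \<noteq> 0" if "v \<noteq> 0" for v
  proof
    assume "A *v v = 0"
    then have "complex_of_real 0 \<in> eigenvalues A"
      using that by (intro real_eigenvector_imp_eigenvalue[of v]) auto
    then show False using assms by (force simp: expanding_def)
  qed
  then show ?thesis
    using matrix_left_invertible_ker[of A] invertible_left_inverse by metis
qed

lemma
  assumes "invertible (A :: real^'n^'n)"
  shows matrix_inv_right: "A ** matrix_inv A = mat 1"
    and matrix_inv_left: "matrix_inv A ** A = mat 1"
proof -
  have "A ** matrix_inv A = mat 1 \<and> matrix_inv A ** A = mat 1"
    unfolding matrix_inv_def by (rule someI_ex) (use assms in \<open>simp add: invertible_def\<close>)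
  then show "A ** matrix_inv A = mat 1" "matrix_inv A ** A = mat 1" by auto
qed

lemma
  assumes "invertible (A :: real^'n^'n)"
  shows mult_matrix_inv_mult: "A *v (matrix_inv A *v x) = x"
    and matrix_inv_mult_mult: "matrix_inv A *v (A *v x) = x"
  using assms by (simp_all add: matrix_vector_mul_assoc matrix_inv_right matrix_inv_left)

lemma inverse_iterate_iterate:
  assumes "invertible (A :: real^'n^'n)"
  shows "((*v) (matrix_inv A) ^^ n) (((*v) A ^^ n) x) = x"
  using assms
  by (induction n) (simp_all add: funpow_swap1[of "(*v) (matrix_inv A)"] matrix_inv_mult_mult)

lemma iterate_inverse_iterate:
  assumes "invertible (A :: real^'n^'n)"
  shows "((*v) A ^^ n) (((*v) (matrix_inv A) ^^ n) x) = x"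
  using assms
  by (induction n) (simp_all add: funpow_swap1[of "(*v) A"] mult_matrix_inv_mult)

lemma map_matrix_mult:
  "map_matrix complex_of_real (A ** B) = map_matrix complex_of_real A ** map_matrix complex_of_real B"
  by (simp add: vec_eq_iff map_matrix_def matrix_matrix_mult_def)

lemma eigenvalues_matrix_inv:
  fixes A :: "real^'n^'n"
  assumes "invertible A" "a \<in> eigenvalues (matrix_inv A)"
  shows "a \<noteq> 0" "inverse a \<in> eigenvalues A"
proof -
  let ?A = "map_matrix complex_of_real A" and ?I = "map_matrix complex_of_real (matrix_inv A)"
  obtain v where v: "v \<noteq> 0" "?I *v v = a *s v"
    using assms(2) by (auto simp: eigenvalues_def)
  have "map_matrix complex_of_real (mat 1 :: real^'n^'n) = mat 1"
    by (simp add: vec_eq_iff map_matrix_def mat_def)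
  then have "?A *v (?I *v v) = v"
    using matrix_inv_right[OF assms(1)] by (simp add: matrix_vector_mul_assoc map_matrix_mult[symmetric])
  then have *: "a *s (?A *v v) = v" by (simp add: v(2) vector_scalar_commute)
  then show "a \<noteq> 0" using v(1) by auto
  have "?A *v v = inverse a *s (a *s (?A *v v))"
    using \<open>a \<noteq> 0\<close> by (simp add: vector_smult_assoc)
  then have "?A *v v = inverse a *s v" by (simp only: *)
  then show "inverse a \<in> eigenvalues A" using v(1) by (auto simp: eigenvalues_def)
qed

lemma inverse_iterate_bound:
  fixes A :: "real^'n^'n"
  assumes "invertible A" "0 < l" "l < min_modulus A"
  obtains C where "0 < C" "\<And>n x. norm (((*v) (matrix_inv A) ^^ n) x) \<le> C * (1 / l) ^ n * norm x"
proof -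
  have "cmod a < 1 / l" if "a \<in> eigenvalues (matrix_inv A)" for a
  proof -
    have "l < cmod (inverse a)"
      using min_modulus_le_cmod[OF eigenvalues_matrix_inv(2)[OF assms(1) that]] assms by linarith
    then have "l < 1 / cmod a" by (simp add: norm_inverse divide_inverse)
    then show ?thesis
      using assms(2) eigenvalues_matrix_inv(1)[OF assms(1) that] by (simp add: field_simps)
  qed
  then show ?thesis
    using iterate_bound[of "matrix_inv A" "1 / l"] assms(2) that by auto
qed

lemma expanding_imp_min_modulus:
  assumes "expanding A"
  shows "1 < min_modulus A"
  using assms finite_eigenvalues[of A] eigenvalues_nonempty[of A]
  by (auto simp: min_modulus_def expanding_def)

lemma min_modulus_le_max_modulus: "min_modulus A \<le> max_modulus A"
  using eigenvalues_nonempty[of A] min_modulus_le_cmod[of _ A] cmod_le_max_modulus[of _ A]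
  by (meson ex_in_conv order_trans)

text \<open>
  The inverse iterates tend to zero, hence so do the powers of \<open>det (matrix_inv A)\<close>. This replaces
  the product formula for the determinant in terms of eigenvalues.
\<close>
lemma expanding_imp_det_gt_1:
  fixes A :: "real^'n^'n"
  assumes "expanding A"
  shows "1 < \<bar>det A\<bar>"
proof (rule ccontr)
  assume "\<not> 1 < \<bar>det A\<bar>"
  have inv: "invertible A" by (rule expanding_imp_invertible[OF assms])
  have d: "det A * det (matrix_inv A) = 1"
    using arg_cong[OF matrix_inv_right[OF inv], of det] by (simp add: det_mul)
  have inv_ge: "1 \<le> \<bar>det (matrix_inv A)\<bar>"
  proof (rule ccontr)
    assume "\<not> 1 \<le> \<bar>det (matrix_inv A)\<bar>"
    then have "\<bar>det A\<bar> * \<bar>det (matrix_inv A)\<bar> < 1"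
      using \<open>\<not> 1 < \<bar>det A\<bar>\<close> mult_right_mono[of "\<bar>det A\<bar>" 1 "\<bar>det (matrix_inv A)\<bar>"] by auto
    then show False using d by (metis abs_mult abs_one less_irrefl)
  qed
  obtain l where l: "1 < l" "l < min_modulus A"
    using expanding_imp_min_modulus[OF assms] dense by blast
  obtain C where C: "\<And>n x. norm (((*v) (matrix_inv A) ^^ n) x) \<le> C * (1 / l) ^ n * norm x"
    by (rule inverse_iterate_bound[OF inv _ l(2)]) (use l in auto)
  define P where "P n = ((**) (matrix_inv A) ^^ n) (mat 1)" for n
  have P: "P n *v x = ((*v) (matrix_inv A) ^^ n) x" for n x
    by (induction n) (simp_all add: P_def matrix_vector_mul_assoc[symmetric])
  have lim0: "(\<lambda>n. C * (1 / l) ^ n) \<longlonglongrightarrow> 0"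
    using l by (intro tendsto_mult_right_zero LIMSEQ_power_zero) auto
  have entry: "(\<lambda>n. P n $ i $ k) \<longlonglongrightarrow> 0" for i k
  proof (rule Lim_null_comparison[OF _ lim0], rule always_eventually, rule allI)
    fix n
    have "P n $ i $ k = (P n *v axis k 1) $ i"
      by (simp add: matrix_vector_mult_basis column_def)
    then show "norm (P n $ i $ k) \<le> C * (1 / l) ^ n"
      using order_trans[OF component_le_norm_cart C[of n "axis k 1"]] by (simp add: P)
  qed
  then have "(\<lambda>n. det (P n)) \<longlonglongrightarrow> (\<Sum>p | p permutes (UNIV :: 'n set). of_int (sign p) * (\<Prod>i\<in>(UNIV :: 'n set). 0))"
    unfolding det_def by (intro tendsto_intros entry)
  then have "(\<lambda>n. det (P n)) \<longlonglongrightarrow> 0" by (simp add: power_0_left)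
  moreover have "det (P n) = det (matrix_inv A) ^ n" for n
    by (induction n) (simp_all add: P_def det_mul)
  ultimately have "(\<lambda>n. \<bar>det (matrix_inv A)\<bar> ^ n) \<longlonglongrightarrow> 0"
    using tendsto_rabs_zero by (force simp: power_abs[symmetric])
  then have "eventually (\<lambda>n. \<bar>det (matrix_inv A)\<bar> ^ n < 1) sequentially"
    by (rule order_tendstoD) simp
  then obtain n where "\<bar>det (matrix_inv A)\<bar> ^ n < 1"
    by (auto simp: eventually_sequentially)
  then show False using one_le_power[OF inv_ge, of n] by linarith
qed

section \<open>Scaling and positivity of the pseudo-norm\<close>

lemma int_iterate_mult:
  assumes "invertible (A :: real^'n^'n)"
  shows "int_iterate A n (A *v x) = int_iterate A (n + 1) x"
proof (cases "n \<ge> 0")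
  case True
  then have "nat (n + 1) = Suc (nat n)" by simp
  then show ?thesis using True by (simp add: int_iterate_def funpow_swap1)
next
  case False
  define k where "k = nat (- n) - 1"
  have n: "n = - int (Suc k)" using False by (simp add: k_def)
  show ?thesis
    by (simp add: n int_iterate_def funpow_Suc_right nat_add_distrib matrix_inv_mult_mult[OF assms]
        del: funpow.simps)
qed

text \<open>
  Applying \<open>A\<close> shifts the summation index by one. The shift is a bijection of the integers, so the
  identity holds whether or not the series converges.
\<close>
lemma pnorm_mult:
  fixes A :: "real^'n^'n"
  assumes "invertible A"
  shows "pnorm A \<phi> (A *v x) = \<bar>det A\<bar> powr (1 / real CARD('n)) * pnorm A \<phi> x"
proof -
  let ?q = "\<bar>det A\<bar>" and ?d = "real CARD('n)"
  define f where "f n = ?q powr (- of_int n / ?d) * smoothed_shell A \<phi> (int_iterate A n x)" for n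
  have q: "?q > 0" using assms by (simp add: invertible_det_nz)
  have "?q powr (- of_int n / ?d) * smoothed_shell A \<phi> (int_iterate A n (A *v x))
      = ?q powr (1 / ?d) * f (n + 1)" for n
  proof -
    have "- of_int n / ?d = 1 / ?d + - of_int (n + 1) / ?d" by (simp add: field_simps)
    then have "?q powr (- of_int n / ?d) = ?q powr (1 / ?d) * ?q powr (- of_int (n + 1) / ?d)"
      by (metis powr_add)
    then show ?thesis by (simp only: f_def int_iterate_mult[OF assms] mult.assoc)
  qed
  then have "pnorm A \<phi> (A *v x) = (\<Sum>\<^sub>\<infinity>n. ?q powr (1 / ?d) * f (n + 1))"
    by (simp add: pnorm_def)
  also have "\<dots> = ?q powr (1 / ?d) * (\<Sum>\<^sub>\<infinity>n. f (n + 1))"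
    by (rule infsum_cmult_right')
  also have "(\<Sum>\<^sub>\<infinity>n. f (n + 1)) = (\<Sum>\<^sub>\<infinity>n. f n)"
    by (rule infsum_reindex_bij_betw) (rule bij_betwI[of _ _ _ "\<lambda>n. n - 1"], auto)
  finally show ?thesis by (simp add: pnorm_def f_def)
qed

lemma pnorm_iterate:
  fixes A :: "real^'n^'n"
  assumes "invertible A"
  shows "pnorm A \<phi> (((*v) A ^^ m) x) = \<bar>det A\<bar> powr (real m / real CARD('n)) * pnorm A \<phi> x"
proof (induction m)
  case 0
  then show ?case using assms by (simp add: invertible_det_nz)
next
  case (Suc m)
  then show ?case
    by (simp add: pnorm_mult[OF assms] powr_add[symmetric] add_divide_distrib)
qed

lemma pnorm_inverse_iterate:
  fixes A :: "real^'n^'n"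
  assumes "invertible A"
  shows "pnorm A \<phi> (((*v) (matrix_inv A) ^^ m) x)
    = \<bar>det A\<bar> powr (- real m / real CARD('n)) * pnorm A \<phi> x"
  using pnorm_iterate[OF assms, of \<phi> m "((*v) (matrix_inv A) ^^ m) x"] assms
  by (simp add: iterate_inverse_iterate powr_minus field_simps invertible_det_nz)

lemma
  assumes "mollifier \<delta> \<phi>"
  shows mollifier_nonneg: "0 \<le> \<phi> x"
    and mollifier_eq_0: "\<delta> \<le> norm x \<Longrightarrow> \<phi> x = 0"
    and mollifier_pos: "norm x < \<delta> \<Longrightarrow> 0 < \<phi> x"
    and mollifier_integrable: "integrable lborel \<phi>"
    and mollifier_integral: "(LINT x|lborel. \<phi> x) = 1"
proof -
  show "(LINT x|lborel. \<phi> x) = 1" using assms by (simp add: mollifier_def)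
  then show "integrable lborel \<phi>" using not_integrable_integral_eq[of lborel \<phi>] by force
  show "\<delta> \<le> norm x \<Longrightarrow> \<phi> x = 0" "norm x < \<delta> \<Longrightarrow> 0 < \<phi> x"
    using assms by (auto simp: mollifier_def)
  then show "0 \<le> \<phi> x" by (cases "norm x < \<delta>") auto
qed

lemma smoothed_shell_nonneg:
  assumes "mollifier \<delta> \<phi>"
  shows "0 \<le> smoothed_shell A \<phi> x"
  unfolding smoothed_shell_def using mollifier_nonneg[OF assms] by (intro Bochner_Integration.integral_nonneg) simp

lemma smoothed_shell_le_1:
  assumes "mollifier \<delta> \<phi>"
  shows "smoothed_shell A \<phi> x \<le> 1"
proof -
  have "smoothed_shell A \<phi> x \<le> (LINT y|lborel. \<phi> y)"
    unfolding smoothed_shell_def using mollifier_nonneg[OF assms]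
    by (intro integral_mono' mollifier_integrable[OF assms]) (auto simp: indicator_def)
  then show ?thesis by (simp add: mollifier_integral[OF assms])
qed

lemma smoothed_shell_eq_0:
  assumes "mollifier \<delta> \<phi>" "norm x \<le> 1 - \<delta>"
  shows "smoothed_shell A \<phi> x = 0"
proof -
  have "indicator (shell A) (x - y) * \<phi> y = 0" for y
  proof (cases "norm y < \<delta>")
    case True
    then have "norm (x - y) < 1" using norm_triangle_ineq4[of x y] assms(2) by linarith
    then show ?thesis by (simp add: shell_def)
  qed (simp add: mollifier_eq_0[OF assms(1)])
  then show ?thesis
    unfolding smoothed_shell_def by (simp only: Bochner_Integration.integral_zero)
qed

lemma mem_shell_iff:
  fixes A :: "real^'n^'n"
  assumes "invertible A"
  shows "x \<in> shell A \<longleftrightarrow> norm (matrix_inv A *v x) < 1 \<and> 1 \<le> norm x"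
proof -
  have "x \<in> (*v) A ` ball 0 1 \<longleftrightarrow> norm (matrix_inv A *v x) < 1"
    using mult_matrix_inv_mult[OF assms, of x, symmetric] matrix_inv_mult_mult[OF assms] by auto
  then show ?thesis by (auto simp: shell_def)
qed

lemma shell_measurable:
  fixes A :: "real^'n^'n"
  assumes "invertible A"
  shows "shell A \<in> sets borel"
proof -
  have "shell A = {x. norm (matrix_inv A *v x) < 1} \<inter> {x. 1 \<le> norm x}"
    using mem_shell_iff[OF assms] by auto
  moreover have "open {x. norm (matrix_inv A *v x) < 1}"
    by (intro open_Collect_less continuous_intros)
  moreover have "closed {x :: real^'n. 1 \<le> norm x}"
    by (intro closed_Collect_le continuous_intros)
  ultimately show ?thesis by auto
qed

lemma bounded_shell: "bounded (shell (A :: real^'n^'n))"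
  unfolding shell_def
  by (rule bounded_subset[OF bounded_linear_image[OF bounded_ball matrix_vector_mul_bounded_linear]]) auto

text \<open>
  Were the integral zero, the ball would be a null set, since \<open>\<phi>\<close> is strictly positive on it.
\<close>
lemma mollifier_integral_ball_pos:
  fixes w :: "real^'n"
  assumes "mollifier \<delta> \<phi>" "0 < e" "ball w e \<subseteq> ball 0 \<delta>"
  shows "0 < (LINT y|lborel. indicator (ball w e) y * \<phi> y)"
proof (rule ccontr)
  assume "\<not> ?thesis"
  moreover have "0 \<le> (LINT y|lborel. indicator (ball w e) y * \<phi> y)"
    using mollifier_nonneg[OF assms(1)] by (intro Bochner_Integration.integral_nonneg) simp
  ultimately have "(LINT y|lborel. indicator (ball w e) y * \<phi> y) = 0" by linarith
  moreover have "integrable lborel (\<lambda>y. indicator (ball w e) y * \<phi> y)"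
    using integrable_mult_indicator[OF _ mollifier_integrable[OF assms(1)], of "ball w e"] by simp
  ultimately have "AE y in lborel. indicator (ball w e) y * \<phi> y = 0"
    using mollifier_nonneg[OF assms(1)] by (subst (asm) integral_nonneg_eq_0_iff_AE) auto
  then have "AE y in lborel. y \<notin> ball w e"
    by (rule AE_mp) (use mollifier_pos[OF assms(1)] assms(3) in \<open>force intro!: AE_I2 simp: indicator_def\<close>)
  then have "ball w e \<in> null_sets lborel"
    by (subst AE_iff_null_sets) auto
  then have "negligible (ball w e)"
    by (simp add: negligible_iff_null_sets null_sets_completionI)
  then show False using open_not_negligible[of "ball w e"] assms(2) by simp
qed

text \<open>
  The ellipsoid \<open>A(B(0,1))\<close> need not contain \<open>B(0,1)\<close>, so a point \<open>z\<close> in the closure of the shell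
  may be a cusp of it. There are however shell points \<open>v\<close> within distance \<open>\<delta>\<close>, and pushing such a
  \<open>v\<close> slightly outwards leads to an interior point \<open>w\<close> of the shell: the ellipsoid is open and
  \<open>norm w > 1\<close>. The part of the convolution integral coming from a small ball around \<open>w\<close> is bounded
  below by a constant that does not depend on \<open>z'\<close> near \<open>z\<close>.
\<close>
lemma smoothed_shell_locally_pos:
  fixes A :: "real^'n^'n"
  assumes A: "invertible A" and \<phi>: "mollifier \<delta> \<phi>" "0 < \<delta>" and z: "z \<in> closure (shell A)"
  shows "\<exists>e>0. \<exists>m>0. \<forall>z'\<in>ball z e. m \<le> smoothed_shell A \<phi> z'"
proof -
  obtain v where v: "v \<in> shell A" "dist v z < \<delta>"
    using z \<phi>(2) by (auto simp: closure_approachable)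
  let ?S = "{x. norm (matrix_inv A *v x) < 1} \<inter> ball z \<delta>"
  have "open ?S" by (intro open_Int open_Collect_less continuous_intros open_ball)
  moreover have "v \<in> ?S" using v mem_shell_iff[OF A] by (simp add: dist_commute)
  ultimately obtain t where t: "0 < t" "ball v t \<subseteq> ?S" by (meson openE)
  have "v \<noteq> 0" and v1: "1 \<le> norm v" using v mem_shell_iff[OF A, of v] by auto
  define w where "w = (1 + t / (2 * norm v)) *\<^sub>R v"
  have "w - v = (t / (2 * norm v)) *\<^sub>R v" by (simp add: w_def algebra_simps)
  then have "norm (w - v) = t / 2" using t(1) \<open>v \<noteq> 0\<close> by simp
  then have "w \<in> ball v t" using t(1) by (simp add: dist_norm norm_minus_commute)
  then have "w \<in> ?S" using t(2) by blast
  moreover have "norm w = (1 + t / (2 * norm v)) * norm v"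
    using t(1) by (simp add: w_def abs_of_nonneg)
  then have "1 < norm w" using t(1) v1 \<open>v \<noteq> 0\<close> by (simp add: algebra_simps)
  ultimately have w: "w \<in> ?S \<inter> {x. 1 < norm x}" by simp
  have "open (?S \<inter> {x. 1 < norm x})"
    using \<open>open ?S\<close> by (intro open_Int open_Collect_less continuous_intros open_ball)
  then obtain s where s: "0 < s" "ball w s \<subseteq> ?S \<inter> {x. 1 < norm x}"
    using w by (meson openE)
  have wz: "dist w z < \<delta>" using w by (simp add: dist_commute)
  \<comment> \<open>\<open>y\<close> and \<open>z'\<close> may each move by \<open>e\<close>, hence \<open>s / 2\<close>; the other bound keeps the ball in the support of \<open>\<phi>\<close>\<close>
  define e where "e = min (s / 2) (\<delta> - dist w z)"
  have e: "0 < e" "2 * e \<le> s" "e + dist w z \<le> \<delta>" using s(1) wz by (auto simp: e_def min_def)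
  define m where "m = (LINT y|lborel. indicator (ball (z - w) e) y * \<phi> y)"
  have "ball (z - w) e \<subseteq> ball 0 \<delta>"
  proof
    fix y assume "y \<in> ball (z - w) e"
    then have "norm (z - w - y) < e" by (simp add: dist_norm)
    moreover have "norm y \<le> norm (z - w) + norm (z - w - y)"
      using norm_triangle_ineq4[of "z - w" "z - w - y"] by simp
    ultimately show "y \<in> ball 0 \<delta>" using e(3) by (simp add: dist_norm norm_minus_commute)
  qed
  then have "0 < m" unfolding m_def by (rule mollifier_integral_ball_pos[OF \<phi>(1) e(1)])
  moreover have "m \<le> smoothed_shell A \<phi> z'" if "z' \<in> ball z e" for z'
    unfolding m_def smoothed_shell_def
  proof (rule integral_mono')
    have [measurable]: "shell A \<in> sets borel" by (rule shell_measurable[OF A])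
    have [measurable]: "\<phi> \<in> borel_measurable borel"
      using borel_measurable_integrable[OF mollifier_integrable[OF \<phi>(1)]] by simp
    show "integrable lborel (\<lambda>y. indicator (shell A) (z' - y) * \<phi> y)"
      by (rule Bochner_Integration.integrable_bound[OF mollifier_integrable[OF \<phi>(1)]])
        (auto simp: indicator_def)
  next
    fix y
    show "0 \<le> indicator (shell A) (z' - y) * \<phi> y" using mollifier_nonneg[OF \<phi>(1)] by simp
    have "z' - y \<in> shell A" if y: "y \<in> ball (z - w) e"
    proof -
      have "norm (z' - y - w) \<le> norm (z' - z) + norm (z - w - y)"
        using norm_triangle_ineq[of "z' - z" "z - w - y"] by (simp add: algebra_simps)
      also have "\<dots> < 2 * e"
        using y \<open>z' \<in> ball z e\<close> by (simp add: dist_norm norm_minus_commute)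
      finally have "z' - y \<in> ball w s" using e(2) by (simp add: dist_norm norm_minus_commute)
      then show ?thesis using s(2) mem_shell_iff[OF A] by auto
    qed
    then show "indicator (ball (z - w) e) y * \<phi> y \<le> indicator (shell A) (z' - y) * \<phi> y"
      using mollifier_nonneg[OF \<phi>(1), of y] by (auto simp: indicator_def)
  qed
  ultimately show ?thesis using e(1) by blast
qed

text \<open>
  Compactness of the closure of the shell makes the local lower bounds uniform.
\<close>
lemma smoothed_shell_ge_on_shell:
  fixes A :: "real^'n^'n"
  assumes A: "invertible A" and \<phi>: "mollifier \<delta> \<phi>" "0 < \<delta>"
  obtains c where "0 < c" "\<And>z. z \<in> shell A \<Longrightarrow> c \<le> smoothed_shell A \<phi> z"
proof -
  obtain e m where em: "\<And>z. z \<in> closure (shell A) \<Longrightarrow>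
      0 < e z \<and> 0 < m z \<and> (\<forall>z'\<in>ball z (e z). m z \<le> smoothed_shell A \<phi> z')"
    using smoothed_shell_locally_pos[OF A \<phi>] by metis
  have comp: "compact (closure (shell A))"
    using bounded_shell by (simp add: compact_closure)
  have cover: "closure (shell A) \<subseteq> (\<Union>z\<in>closure (shell A). ball z (e z))"
    using em by force
  obtain F where F: "F \<subseteq> closure (shell A)" "finite F"
      "closure (shell A) \<subseteq> (\<Union>z\<in>F. ball z (e z))"
    by (rule compactE_image[OF comp open_ball cover]) blast
  define c where "c = Min (insert 1 (m ` F))"
  have "0 < c" using F em by (auto simp: c_def)
  moreover have "c \<le> smoothed_shell A \<phi> z'" if z': "z' \<in> shell A" for z'
  proof -
    obtain z where z: "z \<in> F" "z' \<in> ball z (e z)" using F(3) closure_subset z' by blast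
    have "c \<le> m z" using z(1) F(2) by (simp add: c_def)
    also have "m z \<le> smoothed_shell A \<phi> z'" using em F(1) z by blast
    finally show ?thesis .
  qed
  ultimately show ?thesis by (rule that)
qed

section \<open>Comparison of the pseudo-norm with the Euclidean norm\<close>

lemma pnorm_nonneg:
  assumes "mollifier \<delta> \<phi>"
  shows "0 \<le> pnorm A \<phi> x"
  unfolding pnorm_def
  by (intro infsum_nonneg mult_nonneg_nonneg powr_ge_zero smoothed_shell_nonneg[OF assms])

text \<open>
  For \<open>norm x \<le> K\<close> the points \<open>A ^ (- n) x\<close> lie in a small ball for all \<open>n \<ge> N\<close>, with \<open>N\<close>
  depending on \<open>K\<close> only. There the smoothed shell vanishes, so the sum runs over \<open>n \<ge> - N\<close> and is
  dominated by a geometric series.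
\<close>
lemma pnorm_summable_bounded:
  fixes A :: "real^'n^'n"
  assumes A: "expanding A" and \<phi>: "mollifier \<delta> \<phi>" "\<delta> < 1"
  shows "\<exists>b. \<forall>x. norm x \<le> K \<longrightarrow> pnorm A \<phi> x \<le> b \<and>
    (\<lambda>n. \<bar>det A\<bar> powr (- of_int n / real CARD('n)) * smoothed_shell A \<phi> (int_iterate A n x))
      summable_on UNIV"
proof -
  let ?q = "\<bar>det A\<bar>" and ?d = "real CARD('n)"
  note inv = expanding_imp_invertible[OF A]
  have q: "1 < ?q" by (rule expanding_imp_det_gt_1[OF A])
  obtain l where l: "1 < l" "l < min_modulus A"
    using expanding_imp_min_modulus[OF A] dense by blast
  obtain C where C: "0 < C" "\<And>n x. norm (((*v) (matrix_inv A) ^^ n) x) \<le> C * (1 / l) ^ n * norm x"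
    by (rule inverse_iterate_bound[OF inv _ l(2)]) (use l in auto)
  have "(\<lambda>n. C * (1 / l) ^ n * K) \<longlonglongrightarrow> C * 0 * K"
    using l by (intro tendsto_intros LIMSEQ_power_zero) auto
  then have "eventually (\<lambda>n. C * (1 / l) ^ n * K < 1 - \<delta>) sequentially"
    by (rule order_tendstoD) (use \<phi>(2) in simp)
  then obtain N where N: "\<And>n. N \<le> n \<Longrightarrow> C * (1 / l) ^ n * K < 1 - \<delta>"
    by (auto simp: eventually_sequentially)
  \<comment> \<open>the majorant, with the index shifted so that it starts at \<open>- N\<close>\<close>
  define g where "g k = ?q powr (real N / ?d) * (?q powr (- 1 / ?d)) ^ k" for k :: nat
  have det: "det A \<noteq> 0" using q by auto
  have "?q powr (- 1 / ?d) < 1" using q powr_less_cancel_iff[of ?q "- 1 / ?d" 0] by (simp add: det)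
  then have "summable g" unfolding g_def using q by (intro summable_mult summable_geometric) auto
  then have g: "g summable_on UNIV"
    by (rule summable_nonneg_imp_summable_on) (simp add: g_def)
  show ?thesis
  proof (intro exI[of _ "infsum g UNIV"] allI impI)
    fix x :: "real^'n"
    assume x: "norm x \<le> K"
    define f where "f n = ?q powr (- of_int n / ?d) * smoothed_shell A \<phi> (int_iterate A n x)" for n
    define h where "h k = f (int k - int N)" for k
    have f0: "f n = 0" if "n < - int N" for n
    proof -
      have "norm (int_iterate A n x) \<le> C * (1 / l) ^ nat (- n) * norm x"
        using that C(2) by (simp add: int_iterate_def)
      also have "\<dots> \<le> C * (1 / l) ^ nat (- n) * K"
        using x C(1) l by (intro mult_left_mono) auto
      also have "\<dots> < 1 - \<delta>" using that by (intro N) linarith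
      finally show ?thesis by (simp add: f_def smoothed_shell_eq_0[OF \<phi>(1)])
    qed
    have bij: "bij_betw (\<lambda>k. int k - int N) UNIV {- int N..}"
      by (rule bij_betwI[of _ _ _ "\<lambda>n. nat (n + int N)"]) auto
    have h: "0 \<le> h k" "h k \<le> g k" for k
    proof -
      have exps: "- of_int (int k - int N) / ?d = real N / ?d + real k * (- 1 / ?d)"
        by (simp add: field_simps)
      have "(?q powr (- 1 / ?d)) ^ k = ?q powr (real k * (- 1 / ?d))"
        using q by (simp add: powr_power)
      then have "?q powr (- of_int (int k - int N) / ?d) = g k"
        unfolding g_def exps powr_add by simp
      then have hg: "h k = g k * smoothed_shell A \<phi> (int_iterate A (int k - int N) x)"
        by (simp only: h_def f_def)
      have g0: "0 \<le> g k" by (simp add: g_def)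
      show "0 \<le> h k"
        unfolding hg by (rule mult_nonneg_nonneg[OF g0 smoothed_shell_nonneg[OF \<phi>(1)]])
      show "h k \<le> g k"
        unfolding hg by (rule mult_left_le[OF smoothed_shell_le_1[OF \<phi>(1)] g0])
    qed
    have "summable h"
      by (rule summable_comparison_test'[OF \<open>summable g\<close>, of 0]) (use h in simp)
    then have hs: "h summable_on UNIV"
      by (rule summable_nonneg_imp_summable_on) (rule h(1))
    then have "f summable_on {- int N..}"
      unfolding h_def by (simp add: summable_on_reindex_bij_betw[OF bij])
    moreover have "f summable_on {- int N..} \<longleftrightarrow> f summable_on UNIV"
      by (rule summable_on_cong_neutral) (auto intro: f0)
    ultimately have "f summable_on UNIV" by simp
    then have summable: "(\<lambda>n. ?q powr (- of_int n / ?d) * smoothed_shell A \<phi> (int_iterate A n x))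
        summable_on UNIV"
      by (simp only: f_def[abs_def])
    have "pnorm A \<phi> x = infsum f UNIV" by (simp only: pnorm_def f_def[abs_def])
    also have "\<dots> = infsum f {- int N..}"
      by (rule infsum_cong_neutral) (auto intro: f0)
    also have "\<dots> = infsum h UNIV"
      unfolding h_def by (rule infsum_reindex_bij_betw[OF bij, symmetric])
    also have "\<dots> \<le> infsum g UNIV"
      by (rule infsum_mono[OF hs g]) (rule h(2))
    finally have "pnorm A \<phi> x \<le> infsum g UNIV" .
    then show "pnorm A \<phi> x \<le> infsum g UNIV \<and>
        (\<lambda>n. ?q powr (- of_int n / ?d) * smoothed_shell A \<phi> (int_iterate A n x)) summable_on UNIV"
      using summable by (rule conjI)
  qed
qed

lemma pnorm_ge_smoothed_shell:
  fixes A :: "real^'n^'n"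
  assumes A: "expanding A" and \<phi>: "mollifier \<delta> \<phi>" "\<delta> < 1"
  shows "smoothed_shell A \<phi> x \<le> pnorm A \<phi> x"
proof -
  have det: "det A \<noteq> 0" using expanding_imp_det_gt_1[OF A] by auto
  let ?f = "\<lambda>n. \<bar>det A\<bar> powr (- of_int n / real CARD('n)) * smoothed_shell A \<phi> (int_iterate A n x)"
  obtain b where "\<forall>y. norm y \<le> norm x \<longrightarrow> pnorm A \<phi> y \<le> b \<and>
    (\<lambda>n. \<bar>det A\<bar> powr (- of_int n / real CARD('n)) * smoothed_shell A \<phi> (int_iterate A n y))
      summable_on UNIV"
    using pnorm_summable_bounded[OF A \<phi>, of "norm x"] by (rule exE)
  then have "?f summable_on UNIV" by (rule allE[of _ x]) simp
  then have "sum ?f {0} \<le> infsum ?f UNIV"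
    by (rule finite_sum_le_infsum) (auto intro: mult_nonneg_nonneg smoothed_shell_nonneg[OF \<phi>(1)])
  moreover have "sum ?f {0} = smoothed_shell A \<phi> x" by (simp add: int_iterate_def det)
  ultimately show ?thesis by (simp only: pnorm_def)
qed

lemma pnorm_ge_on_shell:
  fixes A :: "real^'n^'n"
  assumes A: "expanding A" and \<phi>: "mollifier \<delta> \<phi>" "0 < \<delta>" "\<delta> < 1"
  obtains c where "0 < c" "\<And>z. z \<in> shell A \<Longrightarrow> c \<le> pnorm A \<phi> z"
proof -
  obtain c where c: "0 < c" "\<And>z. z \<in> shell A \<Longrightarrow> c \<le> smoothed_shell A \<phi> z"
    using smoothed_shell_ge_on_shell[OF expanding_imp_invertible[OF A] \<phi>(1,2)] by blast
  show ?thesis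
    by (rule that[OF c(1)]) (rule order_trans[OF c(2) pnorm_ge_smoothed_shell[OF A \<phi>(1,3)]])
qed

text \<open>
  Move \<open>x\<close> by the inverse of \<open>A\<close> until the next step enters the unit ball; the last point outside
  the ball is in the shell.
\<close>
lemma outside_ball_shell_orbit:
  fixes A :: "real^'n^'n"
  assumes A: "expanding A" and x: "1 \<le> norm x"
  obtains m z where "z \<in> shell A" "x = ((*v) A ^^ m) z"
proof -
  note inv = expanding_imp_invertible[OF A]
  let ?I = "(*v) (matrix_inv A)"
  obtain l where l: "1 < l" "l < min_modulus A"
    using expanding_imp_min_modulus[OF A] dense by blast
  obtain C where C: "0 < C" "\<And>n x. norm ((?I ^^ n) x) \<le> C * (1 / l) ^ n * norm x"
    by (rule inverse_iterate_bound[OF inv _ l(2)]) (use l in auto)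
  have "(\<lambda>n. C * (1 / l) ^ Suc n * norm x) \<longlonglongrightarrow> C * 0 * norm x"
    using l by (intro tendsto_intros filterlim_compose[OF LIMSEQ_power_zero filterlim_Suc]) auto
  then have "eventually (\<lambda>n. C * (1 / l) ^ Suc n * norm x < 1) sequentially"
    by (rule order_tendstoD) simp
  then obtain n where "C * (1 / l) ^ Suc n * norm x < 1" by (auto simp: eventually_sequentially)
  then have ex: "norm ((?I ^^ Suc n) x) < 1" using C(2)[of "Suc n" x] by linarith
  define m where "m = (LEAST n. norm ((?I ^^ Suc n) x) < 1)"
  have m: "norm ((?I ^^ Suc m) x) < 1" unfolding m_def by (rule LeastI[of _ n]) (rule ex)
  have "1 \<le> norm ((?I ^^ m) x)"
  proof (cases m)
    case 0
    then show ?thesis using x by simp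
  next
    case (Suc k)
    then have "\<not> norm ((?I ^^ Suc k) x) < 1"
      unfolding m_def by (intro not_less_Least) simp
    then show ?thesis using Suc by simp
  qed
  then have "(?I ^^ m) x \<in> shell A" using m by (simp add: mem_shell_iff[OF inv])
  then show ?thesis using that iterate_inverse_iterate[OF inv, of m x] by metis
qed

text \<open>
  Move \<open>x\<close> by \<open>A\<close> until it leaves the unit ball for the first time. It does leave, because \<open>x\<close> is
  recovered from its iterates by the contracting inverse powers.
\<close>
lemma inside_ball_shell_orbit:
  fixes A :: "real^'n^'n"
  assumes A: "expanding A" and x: "norm x < 1" "x \<noteq> 0"
  obtains m z where "z \<in> shell A" "x = ((*v) (matrix_inv A) ^^ m) z"
proof -
  note inv = expanding_imp_invertible[OF A]
  obtain l where l: "1 < l" "l < min_modulus A"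
    using expanding_imp_min_modulus[OF A] dense by blast
  obtain C where C: "0 < C" "\<And>n x. norm (((*v) (matrix_inv A) ^^ n) x) \<le> C * (1 / l) ^ n * norm x"
    by (rule inverse_iterate_bound[OF inv _ l(2)]) (use l in auto)
  have "\<exists>n. 1 \<le> norm (((*v) A ^^ n) x)"
  proof (rule ccontr)
    assume "\<not> ?thesis"
    then have *: "norm (((*v) A ^^ n) x) \<le> 1" for n by (meson linear)
    have "norm x \<le> C * (1 / l) ^ n" for n
    proof -
      have "norm x = norm (((*v) (matrix_inv A) ^^ n) (((*v) A ^^ n) x))"
        by (simp add: inverse_iterate_iterate[OF inv])
      also have "\<dots> \<le> C * (1 / l) ^ n * norm (((*v) A ^^ n) x)" by (rule C(2))
      also have "\<dots> \<le> C * (1 / l) ^ n * 1" using C(1) l by (intro mult_left_mono *) auto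
      finally show ?thesis by simp
    qed
    moreover have "(\<lambda>n. C * (1 / l) ^ n) \<longlonglongrightarrow> C * 0"
      using l by (intro tendsto_intros LIMSEQ_power_zero) auto
    ultimately have "norm x \<le> C * 0"
      by (intro LIMSEQ_le_const[of "\<lambda>n. C * (1 / l) ^ n"]) auto
    then show False using x by simp
  qed
  then obtain n where n: "1 \<le> norm (((*v) A ^^ n) x)" by blast
  define m where "m = (LEAST n. 1 \<le> norm (((*v) A ^^ n) x))"
  have m: "1 \<le> norm (((*v) A ^^ m) x)" unfolding m_def by (rule LeastI[of _ n]) (rule n)
  then obtain k where k: "m = Suc k" using x by (cases m) auto
  then have "\<not> 1 \<le> norm (((*v) A ^^ k) x)"
    unfolding m_def by (intro not_less_Least) simp
  then have "((*v) A ^^ m) x \<in> shell A"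
    using m by (simp add: mem_shell_iff[OF inv] k matrix_inv_mult_mult[OF inv])
  then show ?thesis using that inverse_iterate_iterate[OF inv, of m x] by metis
qed

lemma power_as_powr_of_scale:
  fixes q L d m :: real
  assumes "1 < q" "0 < L" "0 < d"
  shows "(q powr (m / d)) powr (d * ln L / ln q) = L powr m"
  using assms by (simp add: powr_powr powr_def)

text \<open>
  Write \<open>x = A ^ m z\<close> with \<open>z\<close> in the shell. Then \<open>norm x\<close> is at most a multiple of \<open>L ^ m\<close>, and
  \<open>pnorm x\<close> is at least a multiple of \<open>q powr (m / d)\<close>, where \<open>q = \<bar>det A\<bar>\<close>; the exponent is the one
  that turns the second quantity into the first.
\<close>
lemma norm_le_pnorm_outside_ball:
  fixes A :: "real^'n^'n"
  assumes A: "expanding A" and \<phi>: "mollifier \<delta> \<phi>" "0 < \<delta>" "\<delta> < 1" and L: "max_modulus A < L"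
  shows "\<exists>K>0. \<forall>x. 1 \<le> norm x \<longrightarrow>
    norm x \<le> K * pnorm A \<phi> x powr (real CARD('n) * ln L / ln \<bar>det A\<bar>)"
proof -
  let ?q = "\<bar>det A\<bar>" and ?d = "real CARD('n)"
  let ?s = "?d * ln L / ln ?q"
  note inv = expanding_imp_invertible[OF A]
  have q: "1 < ?q" by (rule expanding_imp_det_gt_1[OF A])
  have L1: "1 < L"
    using expanding_imp_min_modulus[OF A] min_modulus_le_max_modulus[of A] L by linarith
  have s: "0 < ?s" using L1 q by simp
  have "cmod a < L" if "a \<in> eigenvalues A" for a
    using cmod_le_max_modulus[OF that] L by linarith
  moreover have "0 \<le> L" using L1 by simp
  ultimately obtain C where C: "0 < C" "\<And>n x. norm (((*v) A ^^ n) x) \<le> C * L ^ n * norm x"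
    by (rule iterate_bound) auto
  obtain R where R: "0 < R" "\<And>z. z \<in> shell A \<Longrightarrow> norm z \<le> R"
    using bounded_shell[of A] by (auto simp: bounded_pos)
  obtain c where c: "0 < c" "\<And>z. z \<in> shell A \<Longrightarrow> c \<le> pnorm A \<phi> z"
    using pnorm_ge_on_shell[OF A \<phi>] by blast
  have "norm x \<le> (C * R / c powr ?s) * pnorm A \<phi> x powr ?s" if x: "1 \<le> norm x" for x
  proof -
    obtain m z where mz: "z \<in> shell A" "x = ((*v) A ^^ m) z"
      by (rule outside_ball_shell_orbit[OF A x])
    have "?q powr (real m / ?d) * c \<le> pnorm A \<phi> x"
      unfolding mz(2) pnorm_iterate[OF inv] by (rule mult_left_mono[OF c(2)[OF mz(1)]]) simp
    then have "(?q powr (real m / ?d) * c) powr ?s \<le> pnorm A \<phi> x powr ?s"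
      using s c(1) by (intro powr_mono2) auto
    then have "L ^ m * c powr ?s \<le> pnorm A \<phi> x powr ?s"
      using q L1 c(1) by (simp add: powr_mult power_as_powr_of_scale powr_realpow)
    then have *: "L ^ m \<le> pnorm A \<phi> x powr ?s / c powr ?s"
      using c(1) by (simp add: pos_le_divide_eq)
    have "norm x \<le> C * L ^ m * norm z" unfolding mz(2) by (rule C(2))
    also have "\<dots> \<le> C * L ^ m * R" using C(1) L1 R(2)[OF mz(1)] by (intro mult_left_mono) auto
    also have "\<dots> = C * R * L ^ m" by simp
    also have "\<dots> \<le> C * R * (pnorm A \<phi> x powr ?s / c powr ?s)"
      using C(1) R(1) by (intro mult_left_mono *) auto
    finally show ?thesis by simp
  qed
  moreover have "0 < C * R / c powr ?s" using C R c by simp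
  ultimately show ?thesis by blast
qed

text \<open>
  As for points outside the ball, with \<open>x = A ^ (- m) z\<close> and the contraction rate \<open>1 / l\<close>. Points of
  norm exactly one are not inside the open ball; they come from the shell by forward iteration, which
  only increases the pseudo-norm.
\<close>
lemma norm_le_pnorm_inside_ball:
  fixes A :: "real^'n^'n"
  assumes A: "expanding A" and \<phi>: "mollifier \<delta> \<phi>" "0 < \<delta>" "\<delta> < 1"
    and l: "1 < l" "l < min_modulus A"
  shows "\<exists>K>0. \<forall>x. norm x \<le> 1 \<longrightarrow>
    norm x \<le> K * pnorm A \<phi> x powr (real CARD('n) * ln l / ln \<bar>det A\<bar>)"
proof -
  let ?q = "\<bar>det A\<bar>" and ?d = "real CARD('n)"
  let ?s = "?d * ln l / ln ?q"
  note inv = expanding_imp_invertible[OF A]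
  have q: "1 < ?q" by (rule expanding_imp_det_gt_1[OF A])
  have s: "0 < ?s" using l(1) q by simp
  obtain C where C: "0 < C" "\<And>n x. norm (((*v) (matrix_inv A) ^^ n) x) \<le> C * (1 / l) ^ n * norm x"
    by (rule inverse_iterate_bound[OF inv _ l(2)]) (use l in auto)
  obtain R where R: "0 < R" "\<And>z. z \<in> shell A \<Longrightarrow> norm z \<le> R"
    using bounded_shell[of A] by (auto simp: bounded_pos)
  obtain c where c: "0 < c" "\<And>z. z \<in> shell A \<Longrightarrow> c \<le> pnorm A \<phi> z"
    using pnorm_ge_on_shell[OF A \<phi>] by blast
  \<comment> \<open>the maximum with 1 serves the points of norm one\<close>
  define K where "K = max 1 (C * R) / c powr ?s"
  have "norm x \<le> K * pnorm A \<phi> x powr ?s" if x: "norm x < 1" "x \<noteq> 0" for x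
  proof -
    obtain m z where mz: "z \<in> shell A" "x = ((*v) (matrix_inv A) ^^ m) z"
      by (rule inside_ball_shell_orbit[OF A x])
    have "?q powr (- real m / ?d) * c \<le> pnorm A \<phi> x"
      unfolding mz(2) pnorm_inverse_iterate[OF inv] by (rule mult_left_mono[OF c(2)[OF mz(1)]]) simp
    then have "(?q powr (- real m / ?d) * c) powr ?s \<le> pnorm A \<phi> x powr ?s"
      using s c(1) by (intro powr_mono2) auto
    moreover have "(?q powr (- real m / ?d)) powr ?s = (1 / l) ^ m"
      using power_as_powr_of_scale[of ?q l ?d "- real m"] q l(1)
      by (simp add: powr_minus powr_realpow power_one_over divide_inverse power_inverse)
    ultimately have "(1 / l) ^ m * c powr ?s \<le> pnorm A \<phi> x powr ?s"
      using c(1) by (simp only: powr_mult)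
    then have *: "(1 / l) ^ m \<le> pnorm A \<phi> x powr ?s / c powr ?s"
      using c(1) by (simp add: pos_le_divide_eq)
    have "norm x \<le> C * (1 / l) ^ m * norm z" unfolding mz(2) by (rule C(2))
    also have "\<dots> \<le> C * (1 / l) ^ m * R" using C(1) l(1) R(2)[OF mz(1)] by (intro mult_left_mono) auto
    also have "\<dots> = C * R * (1 / l) ^ m" by simp
    also have "\<dots> \<le> max 1 (C * R) * (pnorm A \<phi> x powr ?s / c powr ?s)"
      using C(1) R(1) l(1) by (intro mult_mono *) auto
    finally show ?thesis by (simp add: K_def)
  qed
  note inside = this
  have sphere: "norm x \<le> K * pnorm A \<phi> x powr ?s" if x: "norm x = 1" for x
  proof -
    obtain m z where mz: "z \<in> shell A" "x = ((*v) A ^^ m) z"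
      using outside_ball_shell_orbit[OF A] x by (metis order_refl)
    have "1 * c \<le> ?q powr (real m / ?d) * pnorm A \<phi> z"
      using q c(1) c(2)[OF mz(1)] by (intro mult_mono) (auto intro: ge_one_powr_ge_zero)
    then have "c powr ?s \<le> pnorm A \<phi> x powr ?s"
      unfolding mz(2) pnorm_iterate[OF inv] using s c(1) by (intro powr_mono2) auto
    then have "1 \<le> pnorm A \<phi> x powr ?s / c powr ?s" using c(1) by (simp add: pos_le_divide_eq)
    also have "\<dots> \<le> max 1 (C * R) * (pnorm A \<phi> x powr ?s / c powr ?s)"
      using mult_right_mono[of 1 "max 1 (C * R)" "pnorm A \<phi> x powr ?s / c powr ?s"] by simp
    finally show ?thesis using x by (simp add: K_def)
  qed
  have "0 < K" using c by (simp add: K_def)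
  have "norm x \<le> K * pnorm A \<phi> x powr ?s" if le: "norm x \<le> 1" for x
  proof -
    consider "x = 0" | "norm x = 1" | "norm x < 1" "x \<noteq> 0"
      using le order_le_less[of "norm x" 1] by blast
    then show ?thesis using inside sphere \<open>0 < K\<close> by cases simp_all
  qed
  then show ?thesis using \<open>0 < K\<close> by blast
qed

section \<open>The Perron eigenvector and the number of walks\<close>

text \<open>
  Brouwer's fixed point theorem for the normalised action of \<open>M\<close> on the standard simplex. The
  positive power \<open>P n\<close> of \<open>M\<close> excludes \<open>M x = 0\<close> on the simplex, and makes all entries of the fixed
  point positive.
\<close>
lemma perron_eigenvector:
  fixes M :: "real^'v^'v"
  assumes "primitive_matrix M" and nonneg: "\<And>i j. 0 \<le> M $ i $ j"
  obtains v \<rho> where "0 < \<rho>" "\<And>i. 0 < v $ i" "M *v v = \<rho> *\<^sub>R v"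
proof -
  define P where "P k = ((**) M ^^ k) (mat 1)" for k
  obtain n where n: "1 \<le> n" "\<And>i j. 0 < P n $ i $ j"
    using assms(1) by (auto simp: primitive_matrix_def P_def)
  have P: "P k *v x = ((*v) M ^^ k) x" for k x
    by (induction k) (simp_all add: P_def matrix_vector_mul_assoc[symmetric])
  define S where "S = {x :: real^'v. (\<forall>i. 0 \<le> x $ i) \<and> (\<Sum>i\<in>UNIV. x $ i) = 1}"
  define \<sigma> where "\<sigma> x = (\<Sum>i\<in>UNIV. (M *v x) $ i)" for x
  have pos: "0 < (P n *v x) $ i" if "x \<in> S" for x i
  proof -
    obtain l where "x $ l \<noteq> 0" using \<open>x \<in> S\<close> by (force simp: S_def)
    then have "0 < x $ l" using \<open>x \<in> S\<close> by (auto simp: S_def less_le)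
    then show ?thesis unfolding matrix_vector_mult_def
      using \<open>x \<in> S\<close> n(2) by (auto intro!: sum_pos2[of _ l] mult_nonneg_nonneg simp: S_def less_imp_le)
  qed
  have nn: "0 \<le> (M *v x) $ i" if "x \<in> S" for x i
    using that nonneg by (auto simp: matrix_vector_mult_def S_def intro!: sum_nonneg)
  have \<sigma>: "0 < \<sigma> x" if "x \<in> S" for x
  proof (rule ccontr)
    assume "\<not> 0 < \<sigma> x"
    then have "\<sigma> x = 0" using sum_nonneg[of UNIV "\<lambda>i. (M *v x) $ i"] nn[OF that] by (simp add: \<sigma>_def)
    then have "M *v x = 0"
      using nn[OF that] by (simp add: \<sigma>_def sum_nonneg_eq_0_iff vec_eq_iff)
    moreover obtain k where "n = Suc k" using n(1) by (cases n) auto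
    ultimately have "P n *v x = 0"
      by (simp add: P funpow_Suc_right linear_0[OF linear_iterate] del: funpow.simps)
    then show False using pos[OF that] by (metis less_irrefl zero_index)
  qed
  have "compact S"
  proof -
    have "norm x \<le> 1" if "x \<in> S" for x
      using norm_le_l1_cart[of x] that by (simp add: S_def)
    then have "bounded S" by (rule boundedI)
    moreover have "closed S" unfolding S_def
      by (intro closed_Collect_conj closed_Collect_all closed_Collect_le closed_Collect_eq continuous_intros)
    ultimately show ?thesis by (simp add: compact_eq_bounded_closed)
  qed
  moreover have "convex S"
    by (auto simp: convex_def S_def sum.distrib sum_distrib_left[symmetric])
  moreover have "axis undefined 1 \<in> S" by (auto simp: S_def axis_def)
  then have "S \<noteq> {}" by blast
  moreover have "continuous_on S (\<lambda>x. (1 / \<sigma> x) *\<^sub>R (M *v x))"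
    unfolding \<sigma>_def
    by (intro continuous_intros) (use \<sigma> in \<open>force simp: \<sigma>_def\<close>)
  moreover have "(\<lambda>x. (1 / \<sigma> x) *\<^sub>R (M *v x)) \<in> S \<rightarrow> S"
  proof
    fix x assume "x \<in> S"
    then have "(\<Sum>i\<in>UNIV. (M *v x) $ i / \<sigma> x) = 1"
      using \<sigma>[of x] by (simp add: sum_divide_distrib[symmetric]) (simp add: \<sigma>_def)
    then show "(1 / \<sigma> x) *\<^sub>R (M *v x) \<in> S"
      using nn[OF \<open>x \<in> S\<close>] \<sigma>[OF \<open>x \<in> S\<close>] by (auto simp: S_def)
  qed
  ultimately obtain x where x: "x \<in> S" "(1 / \<sigma> x) *\<^sub>R (M *v x) = x"
    by (rule brouwer)
  have "M *v x = \<sigma> x *\<^sub>R ((1 / \<sigma> x) *\<^sub>R (M *v x))" using \<sigma>[OF x(1)] by simp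
  then have eig: "M *v x = \<sigma> x *\<^sub>R x" by (simp only: x(2))
  have "((*v) M ^^ k) x = \<sigma> x ^ k *\<^sub>R x" for k
    by (induction k) (simp_all add: matrix_vector_mult_scaleR eig)
  then have "0 < x $ i" for i
    using pos[OF x(1), of i] \<sigma>[OF x(1)] by (simp add: P zero_less_mult_iff)
  then show ?thesis using that[of "\<sigma> x" x] \<sigma>[OF x(1)] eig by blast
qed

lemma real_eigenvalue_le_max_eigenvalue:
  assumes "v \<noteq> 0" "M *v v = \<rho> *\<^sub>R v"
  shows "\<rho> \<le> max_eigenvalue M"
proof -
  have "{x. complex_of_real x \<in> eigenvalues M} = complex_of_real -` eigenvalues M" by auto
  then have "finite {x. complex_of_real x \<in> eigenvalues M}"
    by (simp add: finite_vimageI[OF finite_eigenvalues] inj_of_real)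
  then show ?thesis
    unfolding max_eigenvalue_def using real_eigenvector_imp_eigenvalue[OF assms] by simp
qed

text \<open>
  The number of walks of length \<open>k\<close> that start at \<open>i\<close>, by recursion on the first arc, as in the
  set equation of the invariant sets.
\<close>
primrec walk_count :: "('v, 'e) pre_digraph \<Rightarrow> nat \<Rightarrow> 'v \<Rightarrow> nat" where
  "walk_count G 0 i = 1"
| "walk_count G (Suc k) i = (\<Sum>e\<in>out_arcs G i. walk_count G k (head G e))"

lemma sum_out_arcs:
  fixes G :: "('v::finite, 'e) pre_digraph" and f :: "'v \<Rightarrow> real"
  assumes "fin_digraph G"
  shows "(\<Sum>e\<in>out_arcs G i. f (head G e)) = (\<Sum>l\<in>UNIV. associated_matrix G $ l $ i * f l)"
proof -
  interpret fin_digraph G by fact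
  have "(\<Sum>e\<in>out_arcs G i. f (head G e))
      = (\<Sum>l\<in>UNIV. \<Sum>e | e \<in> out_arcs G i \<and> head G e = l. f (head G e))"
    by (rule sum.group[symmetric]) auto
  also have "\<dots> = (\<Sum>l\<in>UNIV. associated_matrix G $ l $ i * f l)"
  proof (rule sum.cong[OF refl])
    fix l
    have "{e \<in> out_arcs G i. head G e = l} = {e \<in> arcs G. tail G e = i \<and> head G e = l}"
      by auto
    then show "(\<Sum>e | e \<in> out_arcs G i \<and> head G e = l. f (head G e)) = associated_matrix G $ l $ i * f l"
      by (simp add: associated_matrix_def)
  qed
  finally show ?thesis .
qed

text \<open>
  Walk counts grow by the transpose of the associated matrix, so a right eigenvector is the weight
  for which the total count is multiplied by \<open>\<rho>\<close> in each step.
\<close>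
lemma weighted_walk_count:
  fixes G :: "('v::finite, 'e) pre_digraph"
  assumes G: "fin_digraph G" and v: "associated_matrix G *v v = \<rho> *\<^sub>R v"
  shows "(\<Sum>i\<in>UNIV. v $ i * real (walk_count G k i)) = \<rho> ^ k * (\<Sum>i\<in>UNIV. v $ i)"
proof (induction k)
  case 0
  show ?case by simp
next
  case (Suc k)
  let ?M = "associated_matrix G" and ?N = "\<lambda>i. real (walk_count G k i)"
  have "(\<Sum>i\<in>UNIV. v $ i * real (walk_count G (Suc k) i))
      = (\<Sum>i\<in>UNIV. \<Sum>l\<in>UNIV. v $ i * (?M $ l $ i * ?N l))"
    by (simp add: sum_out_arcs[OF G, of ?N] sum_distrib_left)
  also have "\<dots> = (\<Sum>l\<in>UNIV. (\<Sum>i\<in>UNIV. ?M $ l $ i * v $ i) * ?N l)"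
    unfolding sum_distrib_right by (subst sum.swap) (intro sum.cong refl, simp)
  also have "\<dots> = (\<Sum>l\<in>UNIV. (?M *v v) $ l * ?N l)"
    by (simp add: matrix_vector_mult_def)
  also have "\<dots> = \<rho> * (\<Sum>l\<in>UNIV. v $ l * ?N l)"
    by (simp add: v sum_distrib_left mult_ac)
  finally show ?case by (simp add: Suc)
qed

lemma walk_count_bound:
  fixes G :: "('v::finite, 'e) pre_digraph"
  assumes G: "fin_digraph G" and v: "associated_matrix G *v v = \<rho> *\<^sub>R v" "\<And>i. 0 < v $ i"
  shows "real (walk_count G k i) \<le> (\<Sum>l\<in>UNIV. v $ l) / v $ i * \<rho> ^ k"
proof -
  have "v $ i * real (walk_count G k i) \<le> (\<Sum>i\<in>UNIV. v $ i * real (walk_count G k i))"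
    by (rule member_le_sum) (use v(2) in \<open>auto simp: less_imp_le\<close>)
  then show ?thesis
    using v(2)[of i] weighted_walk_count[OF G v(1), of k] by (simp add: field_simps)
qed

section \<open>Hausdorff measure and dimension of the invariant sets\<close>

text \<open>
  The members of \<open>F\<close> are the pieces of \<open>E i\<close> along the walks of length \<open>k\<close> from \<open>i\<close>. Each map of the system multiplies pseudo-norm
  distances by \<open>q powr (- 1 / d)\<close>, with \<open>q = \<bar>det A\<bar>\<close>.
\<close>
lemma invariant_set_cover:
  fixes G :: "('v::finite, 'e) pre_digraph" and A :: "real^'n^'n"
  assumes G: "fin_digraph G" and A: "invertible A" and E: "invariant_sets G A D E"
    and \<Delta>: "\<And>i x y. x \<in> E i \<Longrightarrow> y \<in> E i \<Longrightarrow> pnorm A \<phi> (x - y) \<le> \<Delta>"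
  shows "\<exists>F. finite F \<and> card F \<le> walk_count G k i \<and> E i \<subseteq> \<Union>F \<and>
    (\<forall>S\<in>F. \<forall>x\<in>S. \<forall>y\<in>S. pnorm A \<phi> (x - y) \<le> \<bar>det A\<bar> powr (- real k / real CARD('n)) * \<Delta>)"
proof (induction k arbitrary: i)
  case 0
  then show ?case using \<Delta> A by (intro exI[of _ "{E i}"]) (auto simp: invertible_det_nz)
next
  case (Suc k)
  interpret fin_digraph G by fact
  let ?q = "\<bar>det A\<bar>" and ?d = "real CARD('n)"
  have q: "0 < ?q" using A by (simp add: invertible_det_nz)
  obtain F where F: "\<And>i. finite (F i) \<and> card (F i) \<le> walk_count G k i \<and> E i \<subseteq> \<Union>(F i) \<and>
      (\<forall>S\<in>F i. \<forall>x\<in>S. \<forall>y\<in>S. pnorm A \<phi> (x - y) \<le> ?q powr (- real k / ?d) * \<Delta>)"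
    using Suc by metis
  define H where "H = (\<Union>e\<in>out_arcs G i. (`) (gmap A D e) ` F (head G e))"
  have fin: "finite (out_arcs G i)"
    by (rule finite_subset[OF _ finite_arcs]) auto
  have "finite H" unfolding H_def using F by auto
  moreover have "card H \<le> walk_count G (Suc k) i"
  proof -
    have "card H \<le> (\<Sum>e\<in>out_arcs G i. card ((`) (gmap A D e) ` F (head G e)))"
      unfolding H_def by (rule card_UN_le[OF fin])
    also have "\<dots> \<le> (\<Sum>e\<in>out_arcs G i. walk_count G k (head G e))"
      using F by (intro sum_mono order_trans[OF card_image_le]) auto
    finally show ?thesis by simp
  qed
  moreover have "E i \<subseteq> \<Union>H"
  proof
    fix x assume "x \<in> E i"
    then obtain e y where e: "e \<in> out_arcs G i" "y \<in> E (head G e)" "x = gmap A D e y"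
      using E unfolding invariant_sets_def by blast
    then obtain S where S: "S \<in> F (head G e)" "y \<in> S" using F by blast
    have "gmap A D e ` S \<in> H" unfolding H_def using e(1) S(1) by blast
    then show "x \<in> \<Union>H" using e(3) S(2) by blast
  qed
  moreover have "pnorm A \<phi> (x - y) \<le> ?q powr (- real (Suc k) / ?d) * \<Delta>"
    if S: "S \<in> H" "x \<in> S" "y \<in> S" for S x y
  proof -
    obtain e T where T: "T \<in> F (head G e)" "S = gmap A D e ` T"
      using S(1) by (auto simp: H_def)
    then obtain x' y' where xy: "x' \<in> T" "y' \<in> T" "x = gmap A D e x'" "y = gmap A D e y'"
      using S(2,3) by blast
    have "x - y = ((*v) (matrix_inv A) ^^ 1) (x' - y')"
      by (simp add: xy gmap_def matrix_vector_mult_diff_distrib[symmetric])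
    then have "pnorm A \<phi> (x - y) = ?q powr (- 1 / ?d) * pnorm A \<phi> (x' - y')"
      using pnorm_inverse_iterate[OF A, of \<phi> 1 "x' - y'"] by simp
    also have "\<dots> \<le> ?q powr (- 1 / ?d) * (?q powr (- real k / ?d) * \<Delta>)"
      using F T(1) xy by (intro mult_left_mono) auto
    also have "\<dots> = ?q powr (- real (Suc k) / ?d) * \<Delta>"
      by (simp add: powr_add[symmetric] mult.assoc[symmetric] diff_divide_distrib)
    finally show ?thesis .
  qed
  ultimately show ?case by blast
qed

lemma hausdorff_pre_le_finite_cover:
  fixes A :: "real^'n^'n"
  assumes F: "finite F" "X \<subseteq> \<Union>F" and t: "0 \<le> t" "t \<le> \<eta>" and s: "0 < s"
    and diam: "\<And>S x y. S \<in> F \<Longrightarrow> x \<in> S \<Longrightarrow> y \<in> S \<Longrightarrow> pnorm A \<phi> (x - y) \<le> t"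
  shows "hausdorff_pre A \<phi> s \<eta> X \<le> ennreal (real (card F) * t powr s)"
proof -
  obtain f where f: "bij_betw f {0..<card F} F" using ex_bij_betw_nat_finite[OF F(1)] by blast
  \<comment> \<open>the cover has to be indexed by all natural numbers; empty sets contribute nothing\<close>
  define S where "S i = (if i < card F then f i else {})" for i
  have S: "S i \<in> F \<or> S i = {}" for i
    using bij_betwE[OF f] by (auto simp: S_def)
  have dw: "diam_w A \<phi> (S i) \<le> ennreal t" for i
    using S[of i] diam by (auto simp: diam_w_def intro!: SUP_least ennreal_leI)
  have dp: "diam_pow A \<phi> s (S i) \<le> ennreal (t powr s)" for i
    using enn2real_leI[OF t(1) dw[of i]] s
    by (auto simp: diam_pow_def intro!: ennreal_leI powr_mono2)
  have "X \<subseteq> (\<Union>i. S i)"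
  proof
    fix x assume "x \<in> X"
    then obtain T where T: "x \<in> T" "T \<in> F" using F(2) by blast
    then obtain i where "i < card F" "f i = T"
      using bij_betw_imp_surj_on[OF f] by (metis atLeastLessThan_iff imageE)
    then show "x \<in> (\<Union>i. S i)" using T(1) by (auto simp: S_def intro!: exI[of _ i])
  qed
  moreover have "diam_w A \<phi> (S i) \<le> ennreal \<eta>" for i
    using dw[of i] t(2) by (meson ennreal_leI order_trans)
  ultimately have "hausdorff_pre A \<phi> s \<eta> X \<le> (\<Sum>i. diam_pow A \<phi> s (S i))"
    unfolding hausdorff_pre_def by (intro Inf_lower) blast
  also have "\<dots> = (\<Sum>i<card F. diam_pow A \<phi> s (S i))"
    by (rule suminf_finite) (auto simp: S_def diam_pow_def)
  also have "\<dots> \<le> (\<Sum>i<card F. ennreal (t powr s))"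
    by (rule sum_mono) (rule dp)
  also have "\<dots> = ennreal (real (card F) * t powr s)"
    by (simp add: ennreal_mult' ennreal_of_nat_eq_real_of_nat)
  finally show ?thesis .
qed

lemma hausdorff_w_eqI:
  assumes "\<And>\<eta>. 0 < \<eta> \<Longrightarrow> hausdorff_pre A \<phi> s \<eta> X = c"
  shows "hausdorff_w A \<phi> s X = c"
  unfolding hausdorff_w_def
proof (rule tendsto_Lim)
  show "((\<lambda>\<eta>. hausdorff_pre A \<phi> s \<eta> X) \<longlongrightarrow> c) (at_right 0)"
    by (rule tendsto_eventually, rule eventually_mono[OF eventually_at_right_less]) (rule assms)
qed simp

text \<open>
  The cover by walks of length \<open>k\<close> has at most a multiple of \<open>\<rho> ^ k\<close> sets, each contributing a
  multiple of \<open>r powr (k s)\<close> with \<open>r = q powr (- 1 / d)\<close>; the hypothesis on \<open>s\<close> says that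
  \<open>\<rho> * r powr s < 1\<close>.
\<close>
lemma hausdorff_w_invariant_set_eq_0:
  fixes G :: "('v::finite, 'e) pre_digraph" and A :: "real^'n^'n"
  assumes G: "fin_digraph G" and A: "expanding A" and E: "invariant_sets G A D E"
    and \<phi>: "mollifier \<delta> \<phi>" "\<delta> < 1"
    and v: "associated_matrix G *v v = \<rho> *\<^sub>R v" "\<And>i. 0 < v $ i" "0 < \<rho>"
    and s: "0 < s" "real CARD('n) * ln \<rho> / ln \<bar>det A\<bar> < s"
  shows "hausdorff_w A \<phi> s (E j) = 0"
proof (rule hausdorff_w_eqI)
  fix \<eta> :: real
  assume \<eta>: "0 < \<eta>"
  let ?q = "\<bar>det A\<bar>" and ?d = "real CARD('n)"
  have q: "1 < ?q" by (rule expanding_imp_det_gt_1[OF A])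
  have det: "det A \<noteq> 0" using q by auto
  have "compact (E i)" for i using E unfolding invariant_sets_def by blast
  then have "bounded (\<Union>i. E i)" by (intro bounded_UN) (simp_all add: compact_imp_bounded)
  then obtain R where R: "\<And>x i. x \<in> E i \<Longrightarrow> norm x \<le> R"
    by (auto simp: bounded_iff)
  obtain b where b: "\<And>x. norm x \<le> R + R \<Longrightarrow> pnorm A \<phi> x \<le> b"
    using pnorm_summable_bounded[OF A \<phi>, of "R + R"] by blast
  \<comment> \<open>positive, so that \<open>powr\<close> distributes over \<open>r ^ k * \<Delta>\<close>\<close>
  define \<Delta> where "\<Delta> = max 1 b"
  have \<Delta>: "pnorm A \<phi> (x - y) \<le> \<Delta>" if "x \<in> E i" "y \<in> E i" for i x y
  proof -
    have "norm (x - y) \<le> R + R"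
      using R[OF that(1)] R[OF that(2)] norm_triangle_ineq4[of x y] by linarith
    then show ?thesis using b by (fastforce simp: \<Delta>_def)
  qed
  define r where "r = ?q powr (- 1 / ?d)"
  have r: "0 < r" "r < 1"
    using q det powr_less_cancel_iff[of ?q "- 1 / ?d" 0] by (simp_all add: r_def)
  have rk: "?q powr (- real k / ?d) = r ^ k" for k
    using q by (simp add: r_def powr_realpow[symmetric] powr_powr)
  have "\<rho> * r powr s < 1"
  proof -
    have "ln (\<rho> * r powr s) = ln \<rho> - s * ln ?q / ?d"
      using v(3) q by (simp add: ln_mult r_def powr_powr ln_powr)
    also have "\<dots> < 0" using s(2) q by (simp add: field_simps)
    finally show ?thesis using v(3) r by simp
  qed
  moreover have "0 < \<rho> * r powr s" using v(3) r by simp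
  ultimately have geo: "(\<lambda>k. (\<rho> * r powr s) ^ k) \<longlonglongrightarrow> 0"
    by (intro LIMSEQ_power_zero) simp
  define B where "B = (\<Sum>l\<in>UNIV. v $ l) / v $ j * \<Delta> powr s"
  have bound: "hausdorff_pre A \<phi> s \<eta> (E j) \<le> ennreal (B * (\<rho> * r powr s) ^ k)"
    if k: "r ^ k * \<Delta> \<le> \<eta>" for k
  proof -
    have "\<exists>F. finite F \<and> card F \<le> walk_count G k j \<and> E j \<subseteq> \<Union>F \<and>
        (\<forall>S\<in>F. \<forall>x\<in>S. \<forall>y\<in>S. pnorm A \<phi> (x - y) \<le> ?q powr (- real k / ?d) * \<Delta>)"
      by (rule invariant_set_cover[OF G expanding_imp_invertible[OF A] E]) (rule \<Delta>)
    then obtain F where F: "finite F" "card F \<le> walk_count G k j" "E j \<subseteq> \<Union>F"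
        and diam: "\<forall>S\<in>F. \<forall>x\<in>S. \<forall>y\<in>S. pnorm A \<phi> (x - y) \<le> r ^ k * \<Delta>"
      unfolding rk by (elim exE conjE)
    have "hausdorff_pre A \<phi> s \<eta> (E j) \<le> ennreal (real (card F) * (r ^ k * \<Delta>) powr s)"
      by (rule hausdorff_pre_le_finite_cover[OF F(1,3) _ k s(1)])
        (use r diam in \<open>auto simp: \<Delta>_def\<close>)
    also have "\<dots> \<le> ennreal (((\<Sum>l\<in>UNIV. v $ l) / v $ j * \<rho> ^ k) * (r ^ k * \<Delta>) powr s)"
      using walk_count_bound[OF G v(1,2), of k j] F(2)
      by (intro ennreal_leI mult_right_mono) auto
    also have "(r ^ k * \<Delta>) powr s = (r powr s) ^ k * \<Delta> powr s"
      using r by (simp add: powr_mult \<Delta>_def powr_realpow[symmetric] powr_powr mult.commute)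
    finally show ?thesis by (simp add: B_def power_mult_distrib mult_ac)
  qed
  have "(\<lambda>k. r ^ k * \<Delta>) \<longlonglongrightarrow> 0 * \<Delta>"
    using r by (intro tendsto_intros LIMSEQ_power_zero) auto
  then have "eventually (\<lambda>k. r ^ k * \<Delta> < \<eta>) sequentially"
    by (rule order_tendstoD) (use \<eta> in simp)
  then have ev: "eventually (\<lambda>k. hausdorff_pre A \<phi> s \<eta> (E j) \<le> ennreal (B * (\<rho> * r powr s) ^ k)) sequentially"
    by (rule eventually_mono) (rule bound, simp)
  have "(\<lambda>k. ennreal (B * (\<rho> * r powr s) ^ k)) \<longlonglongrightarrow> ennreal (B * 0)"
    by (intro tendsto_ennrealI tendsto_intros geo)
  then have "hausdorff_pre A \<phi> s \<eta> (E j) \<le> ennreal (B * 0)"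
    by (rule tendsto_lowerbound[OF _ ev]) simp
  then show "hausdorff_pre A \<phi> s \<eta> (E j) = 0" by simp
qed

lemma dim_w_invariant_set_le:
  fixes G :: "('v::finite, 'e) pre_digraph" and A :: "real^'n^'n"
  assumes G: "fin_digraph G" and A: "expanding A" and E: "invariant_sets G A D E"
    and \<phi>: "mollifier \<delta> \<phi>" "\<delta> < 1"
    and v: "associated_matrix G *v v = \<rho> *\<^sub>R v" "\<And>i. 0 < v $ i" "0 < \<rho>"
  shows "0 \<le> dim_w A \<phi> (E j)"
    and "dim_w A \<phi> (E j) \<le> max 0 (real CARD('n) * ln \<rho> / ln \<bar>det A\<bar>)"
proof -
  let ?Z = "{s. 0 \<le> s \<and> hausdorff_w A \<phi> s (E j) = 0}"
  let ?m = "max 0 (real CARD('n) * ln \<rho> / ln \<bar>det A\<bar>)"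
  have Z: "s \<in> ?Z" if "?m < s" for s
    using hausdorff_w_invariant_set_eq_0[OF assms, of s j] that by simp
  have "?m + 1 \<in> ?Z" by (rule Z) simp
  then have "?Z \<noteq> {}" by blast
  then show "0 \<le> dim_w A \<phi> (E j)" unfolding dim_w_def by (rule cInf_greatest) simp
  have "bdd_below ?Z" by (rule bdd_belowI[of _ 0]) simp
  then have "dim_w A \<phi> (E j) \<le> s" if "?m < s" for s
    unfolding dim_w_def by (intro cInf_lower Z that)
  then show "dim_w A \<phi> (E j) \<le> ?m" by (rule dense_ge)
qed

lemma pnorm_0:
  assumes "mollifier \<delta> \<phi>" "\<delta> < 1"
  shows "pnorm A \<phi> 0 = 0"
proof -
  have "int_iterate A n 0 = 0" for n
    by (simp add: int_iterate_def linear_0[OF linear_iterate])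
  then show ?thesis
    using assms by (simp add: pnorm_def smoothed_shell_eq_0[OF assms(1)])
qed

lemma hausdorff_w_0_singleton:
  assumes "mollifier \<delta> \<phi>" "\<delta> < 1"
  shows "hausdorff_w A \<phi> 0 {p} = 1"
proof (rule hausdorff_w_eqI, rule antisym)
  fix \<eta> :: real assume "0 < \<eta>"
  define S where "S i = (if i = 0 then {p} else {})" for i :: nat
  have "(\<Sum>i. diam_pow A \<phi> 0 (S i)) = (\<Sum>i\<in>{0}. diam_pow A \<phi> 0 (S i))"
    by (rule suminf_finite) (auto simp: S_def diam_pow_def)
  then have "(\<Sum>i. diam_pow A \<phi> 0 (S i)) = 1" by (simp add: S_def diam_pow_def)
  moreover have "{p} \<subseteq> (\<Union>i. S i)" by (auto simp: S_def intro!: exI[of _ 0])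
  moreover have "diam_w A \<phi> (S i) \<le> ennreal \<eta>" for i
    by (simp add: S_def diam_w_def pnorm_0[OF assms])
  ultimately show "hausdorff_pre A \<phi> 0 \<eta> {p} \<le> 1"
    unfolding hausdorff_pre_def by (intro Inf_lower) (auto intro!: exI[of _ S])
next
  fix \<eta> :: real
  show "1 \<le> hausdorff_pre A \<phi> 0 \<eta> {p}"
    unfolding hausdorff_pre_def
  proof (rule Inf_greatest, safe)
    fix S :: "nat \<Rightarrow> (real^'a) set"
    assume "{p} \<subseteq> (\<Union>i. S i)"
    then obtain i where "p \<in> S i" by auto
    then have "1 = (\<Sum>i\<in>{i}. diam_pow A \<phi> 0 (S i))" by (auto simp: diam_pow_def)
    also have "\<dots> \<le> (\<Sum>i. diam_pow A \<phi> 0 (S i))" by (rule sum_le_suminf) auto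
    finally show "1 \<le> (\<Sum>i. diam_pow A \<phi> 0 (S i))" .
  qed
qed

text \<open>
  For \<open>\<alpha> = 0\<close> the measure counts points, whereas a measure isomorphism gives the image of the
  Lebesgue null set \<open>{0}\<close> measure zero. The case matters because \<open>1 / \<alpha>\<close> would be 0 by default
  and the given bound on the pseudo-norm would carry no information.
\<close>
lemma measure_isomorphism_dim_nonzero:
  assumes "mollifier \<delta> \<phi>" "\<delta> < 1" "measure_isomorphism A \<phi> \<alpha> X \<psi>"
  shows "\<alpha> \<noteq> 0"
proof
  assume "\<alpha> = 0"
  have iso: "\<forall>F\<in>sets borel. F \<subseteq> {0..1} \<longrightarrow>
      hausdorff_w A \<phi> \<alpha> (\<psi> ` F) = hausdorff_w A \<phi> \<alpha> X * emeasure lborel F"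
    using assms(3) unfolding measure_isomorphism_def Let_def by (elim conjE)
  have "hausdorff_w A \<phi> \<alpha> (\<psi> ` {0}) = hausdorff_w A \<phi> \<alpha> X * emeasure lborel {0 :: real}"
    by (rule iso[THEN bspec, THEN mp]) simp_all
  then show False
    by (simp add: \<open>\<alpha> = 0\<close> hausdorff_w_0_singleton[OF assms(1,2)])
qed

section \<open>The Hoelder estimates\<close>

text \<open>
  Since \<open>t \<le> 1\<close>, a smaller \<open>\<alpha>\<close> only improves the bound on \<open>p\<close>, so \<open>\<alpha>\<close> may be replaced by its
  upper bound \<open>d * ln \<Lambda> / ln q\<close>; then \<open>d\<close> and \<open>ln q\<close> cancel from the exponent.
\<close>
lemma hoelder_transfer:
  fixes q L \<Lambda> d \<alpha> c K p n t :: real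
  assumes q: "1 < q" and L: "1 < L" and \<Lambda>: "1 < \<Lambda>" and d: "0 < d"
    and \<alpha>: "0 < \<alpha>" "\<alpha> \<le> d * ln \<Lambda> / ln q"
    and p: "0 \<le> p" "p \<le> c * t powr (1 / \<alpha>)" and t: "0 \<le> t" "t \<le> 1" and "0 < c" "0 < K"
    and n: "n \<le> K * p powr (d * ln L / ln q)"
  shows "n \<le> K * c powr (d * ln L / ln q) * t powr (ln L / ln \<Lambda>)"
proof -
  let ?s = "d * ln L / ln q" and ?a = "d * ln \<Lambda> / ln q"
  have "0 < ?a" using \<alpha> by linarith
  then have "1 / ?a \<le> 1 / \<alpha>"
    by (rule divide_left_mono[OF \<alpha>(2) zero_le_one mult_pos_pos[OF _ \<alpha>(1)]])
  then have "t powr (1 / \<alpha>) \<le> t powr (1 / ?a)" using t by (intro powr_mono') auto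
  then have "p \<le> c * t powr (1 / ?a)"
    using p(2) \<open>0 < c\<close> by (meson mult_left_mono less_imp_le order_trans)
  then have "p powr ?s \<le> (c * t powr (1 / ?a)) powr ?s"
    using p(1) q L d by (intro powr_mono2) auto
  also have "\<dots> = c powr ?s * t powr (1 / ?a * ?s)"
    using \<open>0 < c\<close> by (simp add: powr_mult powr_powr)
  also have "1 / ?a * ?s = ln L / ln \<Lambda>" using q d by simp
  finally have "K * p powr ?s \<le> K * (c powr ?s * t powr (ln L / ln \<Lambda>))"
    using \<open>0 < K\<close> by (intro mult_left_mono) auto
  then show ?thesis using n by (simp add: mult.assoc)
qed

theorem corollary1p3:
  fixes G :: "('v::finite, 'e) pre_digraph"
    and A :: "real^'n^'n"
    and D :: "'e \<Rightarrow> real^'n"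
    and r :: "('e \<times> 'e) set"
    and E :: "'v \<Rightarrow> (real^'n) set"
    and \<phi> :: "real^'n \<Rightarrow> real"
    and \<psi> :: "real \<Rightarrow> real^'n"
    and \<delta> \<alpha> \<epsilon> :: real
    and j :: 'v
  assumes "linear_gifs G A D E r"
    and "open_set_condition G A D"
    and "primitive_matrix (associated_matrix G)"
    and "0 < \<delta>" and "\<delta> < 1/2" and "mollifier \<delta> \<phi>"
    and "\<alpha> = dim_w A \<phi> (E j)"
    and "parametrization (E j) \<psi>"
    and "measure_isomorphism A \<phi> \<alpha> (E j) \<psi>"
    and "\<exists>c>0. \<forall>x\<in>{0..1}. \<forall>y\<in>{0..1}. pnorm A \<phi> (\<psi> x - \<psi> y) \<le> c * \<bar>x - y\<bar> powr (1 / \<alpha>)"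
    and "0 < \<epsilon>" and "\<epsilon> < min_modulus A - 1"
  shows "(\<exists>C>0. \<forall>x\<in>{0..1}. \<forall>y\<in>{0..1}. norm (\<psi> x - \<psi> y) \<ge> 1 \<longrightarrow>
           norm (\<psi> x - \<psi> y) \<le>
             C * \<bar>x - y\<bar> powr (ln (max_modulus A + \<epsilon>) / ln (max_eigenvalue (associated_matrix G))))
       \<and> (\<exists>C>0. \<forall>x\<in>{0..1}. \<forall>y\<in>{0..1}. norm (\<psi> x - \<psi> y) \<le> 1 \<longrightarrow>
           norm (\<psi> x - \<psi> y) \<le>
             C * \<bar>x - y\<bar> powr (ln (min_modulus A - \<epsilon>) / ln (max_eigenvalue (associated_matrix G))))"
proof -
  let ?M = "associated_matrix G" and ?q = "\<bar>det A\<bar>" and ?d = "real CARD('n)"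
  have G: "fin_digraph G" and A: "expanding A" and E: "invariant_sets G A D E"
    using assms(1) by (simp_all add: linear_gifs_def gifs_def)
  have \<delta>: "\<delta> < 1" using assms(5) by simp
  note \<phi> = \<open>mollifier \<delta> \<phi>\<close>
  have q: "1 < ?q" by (rule expanding_imp_det_gt_1[OF A])
  obtain v \<rho> where v: "0 < \<rho>" "\<And>i. 0 < v $ i" "?M *v v = \<rho> *\<^sub>R v"
    by (rule perron_eigenvector[OF assms(3)]) (auto simp: associated_matrix_def)
  have "v \<noteq> 0" using v(2) by (metis less_irrefl zero_index)
  then have \<rho>_le: "\<rho> \<le> max_eigenvalue ?M" by (rule real_eigenvalue_le_max_eigenvalue) (rule v(3))
  have "\<alpha> \<noteq> 0" by (rule measure_isomorphism_dim_nonzero[OF \<phi> \<delta> assms(9)])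
  then have \<alpha>: "0 < \<alpha>" "\<alpha> \<le> ?d * ln \<rho> / ln ?q"
    using dim_w_invariant_set_le[OF G A E \<phi> \<delta> v(3,2,1), of j] assms(7) by auto
  then have "0 < ?d * ln \<rho> / ln ?q" by linarith
  then have "1 < \<rho>" using q v(1) by (simp add: zero_less_divide_iff zero_less_mult_iff)
  then have \<Lambda>: "1 < max_eigenvalue ?M" using \<rho>_le by linarith
  have \<alpha>_le: "\<alpha> \<le> ?d * ln (max_eigenvalue ?M) / ln ?q"
    using \<alpha>(2) \<rho>_le v(1) q
    by (elim order_trans) (intro divide_right_mono mult_left_mono, auto)
  obtain c where c: "0 < c" "\<And>x y. x \<in> {0..1} \<Longrightarrow> y \<in> {0..1} \<Longrightarrow>
      pnorm A \<phi> (\<psi> x - \<psi> y) \<le> c * \<bar>x - y\<bar> powr (1 / \<alpha>)"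
    using assms(10) by blast
  have transfer: "norm (\<psi> x - \<psi> y)
      \<le> K * c powr (?d * ln L / ln ?q) * \<bar>x - y\<bar> powr (ln L / ln (max_eigenvalue ?M))"
    if "x \<in> {0..1}" "y \<in> {0..1}" "1 < L" "0 < K"
      "norm (\<psi> x - \<psi> y) \<le> K * pnorm A \<phi> (\<psi> x - \<psi> y) powr (?d * ln L / ln ?q)" for x y K L
    by (rule hoelder_transfer[OF q \<open>1 < L\<close> \<Lambda> _ \<alpha>(1) \<alpha>_le pnorm_nonneg[OF \<phi>] c(2)[OF that(1,2)] _ _ c(1)
          \<open>0 < K\<close> that(5)]) (use that in auto)
  define L where "L = max_modulus A + \<epsilon>"
  define l where "l = min_modulus A - \<epsilon>"
  have L: "1 < L" "max_modulus A < L" and l: "1 < l" "l < min_modulus A"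
    using assms(11,12) min_modulus_le_max_modulus[of A] by (auto simp: L_def l_def)
  obtain K where K: "0 < K" "\<And>x. 1 \<le> norm x \<Longrightarrow> norm x \<le> K * pnorm A \<phi> x powr (?d * ln L / ln ?q)"
    using norm_le_pnorm_outside_ball[OF A \<phi> assms(4) \<delta> L(2)] by blast
  obtain k where k: "0 < k" "\<And>x. norm x \<le> 1 \<Longrightarrow> norm x \<le> k * pnorm A \<phi> x powr (?d * ln l / ln ?q)"
    using norm_le_pnorm_inside_ball[OF A \<phi> assms(4) \<delta> l] by blast
  show ?thesis
    unfolding L_def[symmetric] l_def[symmetric]
  proof (intro conjI)
    show "\<exists>C>0. \<forall>x\<in>{0..1}. \<forall>y\<in>{0..1}. norm (\<psi> x - \<psi> y) \<ge> 1 \<longrightarrow>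
        norm (\<psi> x - \<psi> y) \<le> C * \<bar>x - y\<bar> powr (ln L / ln (max_eigenvalue ?M))"
      using transfer[OF _ _ L(1) K(1) K(2)] K(1) c(1)
      by (intro exI[of _ "K * c powr (?d * ln L / ln ?q)"]) auto
    show "\<exists>C>0. \<forall>x\<in>{0..1}. \<forall>y\<in>{0..1}. norm (\<psi> x - \<psi> y) \<le> 1 \<longrightarrow>
        norm (\<psi> x - \<psi> y) \<le> C * \<bar>x - y\<bar> powr (ln l / ln (max_eigenvalue ?M))"
      using transfer[OF _ _ l(1) k(1) k(2)] k(1) c(1)
      by (intro exI[of _ "k * c powr (?d * ln l / ln ?q)"]) auto
  qed
qed

end
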